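(* Let $V, H$ be real separable Hilbert spaces with $V$ compactly and densely embedded in $H$. Let $A:V\to V^*$ be a bounded linear operator for which there is a constant $\mu_V>0$ with $\langle Au,u\rangle_{V^*\times V}\ge\mu_V\|u\|_V^2$ for all $u\in V$, and let $\mu_H>0$ be a constant with $\langle Au,u\rangle_{V^*\times V}\ge\mu_H\|u\|_H^2$ for all $u\in V$. Let $\gamma$ satisfy $0\le\gamma<\mu_H$. Then for every $Q\in C_{-\gamma^2}$ there exists $P\in\mathcal{V}\cap C_{-\gamma}$ such that $$A^*P+PA+P^2=Q.$$
   Context: $H$ is identified with its dual, giving the Gelfand triple $V\hookrightarrow H\cong H^*\hookrightarrow V^*$; the pairing $\langle\cdot,\cdot\rangle_{V^*\times V}$ extends the inner product $(\cdot,\cdot)_H$. $A^*:V\to V^*$ is the dual operator of $A$: $\langle A^*u,v\rangle_{V^*\times V}=\langle Av,u\rangle_{V^*\times V}$. For separable Hilbert spaces $X,Y$, $\mathcal{HS}(X,Y)$ is the Hilbert space of Hilbert--Schmidt operators $X\to Y$. Put $$\mathcal{V}=\mathcal{HS}(V^*,H)\cap\mathcal{HS}(H,V),\quad \mathcal{H}=\mathcal{HS}(H,H),\quad \mathcal{V}^*=\mathcal{HS}(V,H)+\mathcal{HS}(H,V^* ),$$ all regarded as subsets of the bounded operators from $V$ to $V^*$, so that $\mathcal{V}\subseteq\mathcal{H}\subseteq\mathcal{V}^*$. For $P\in\mathcal{V}$ one has $A^*P\in\mathcal{HS}(H,V^* )$ and $PA\in\mathcal{HS}(V,H)$, and the equation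 is understood in $\mathcal{V}^*$. For a self-adjoint $P\in\mathcal{H}$ and $\beta\in\mathbb{R}$, $P\ge\beta$ means every eigenvalue of $P$ is $\ge\beta$, i.e. $((P-\beta I)u,u)_H\ge0$ for all $u\in H$. For $\beta\in\mathbb{R}$, $C_{-\beta}=\{P\in\mathcal{H}: P=P^*,\ P\ge-\beta\}$. The constant $\mu_H$ always exists (e.g. $\mu_H=\mu_V/C_{V,H}^2$ where $\|v\|_H\le C_{V,H}\|v\|_V$ for $v\in V$), but may be any constant satisfying the stated inequality. *)

theory Defs
  imports "HOL-Analysis.Analysis"
begin

section \<open>The dual of a Hilbert space as a Hilbert space\<close>

theorem riesz_representation:
  fixes f :: "'a::{real_inner,banach} \<Rightarrow>\<^sub>L real"
  shows "\<exists>v. \<forall>x. f x = v \<bullet> x"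
proof -
  define J where "J v = (v \<bullet> v) / 2 - f v" for v
  have lower: "J v \<ge> - (norm f)\<^sup>2 / 2" for v
  proof -
    have "f v \<le> norm f * norm v"
      using norm_blinfun[of f v] by simp
    moreover have "2 * (norm f * norm v) \<le> (norm f)\<^sup>2 + (norm v)\<^sup>2"
      using sum_squares_bound[of "norm f" "norm v"] by simp
    ultimately show ?thesis
      by (simp add: J_def power2_norm_eq_inner field_simps)
  qed
  define m where "m = Inf (range J)"
  have bdd: "bdd_below (range J)"
    using lower by (auto intro!: bdd_belowI)
  have m_le: "m \<le> J v" for v
    unfolding m_def by (rule cInf_lower[OF _ bdd]) auto
  have "\<exists>v. J v < m + 1 / Suc n" for n
    using cInf_lessD[of "range J" "m + 1 / Suc n"] unfolding m_def by auto
  then obtain v where v: "\<And>n. J (v n) < m + 1 / Suc n"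
    by metis
  have gap: "(norm (x - y))\<^sup>2 = 8 * (J x / 2 + J y / 2 - J ((1/2) *\<^sub>R (x + y)))" for x y
    by (simp add: J_def power2_norm_eq_inner blinfun.bilinear_simps inner_simps
        inner_commute field_simps)
  have est: "(norm (v k - v l))\<^sup>2 \<le> 8 * (1 / Suc n)" if "n \<le> k" "n \<le> l" for k l n
  proof -
    have "1 / real (Suc k) \<le> 1 / Suc n" "1 / real (Suc l) \<le> 1 / Suc n"
      using that by (simp_all add: frac_le)
    then have "J (v k) \<le> m + 1 / Suc n" "J (v l) \<le> m + 1 / Suc n"
      using v[of k] v[of l] by linarith+
    then show ?thesis
      using m_le[of "(1/2) *\<^sub>R (v k + v l)"] unfolding gap by argo
  qed
  have "Cauchy v"
  proof (rule metric_CauchyI)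
    fix e :: real assume "0 < e"
    then obtain n where n: "8 * inverse (real (Suc n)) < e\<^sup>2"
      using reals_Archimedean[of "e\<^sup>2 / 8"] by (auto simp: mult.commute)
    have "dist (v k) (v l) < e" if "n \<le> k" "n \<le> l" for k l
    proof -
      have "(norm (v k - v l))\<^sup>2 < e\<^sup>2"
        using est[OF that] n by (simp add: inverse_eq_divide)
      then show ?thesis
        using \<open>0 < e\<close> by (simp add: dist_norm power_less_imp_less_base)
    qed
    then show "\<exists>M. \<forall>k\<ge>M. \<forall>l\<ge>M. dist (v k) (v l) < e"
      by blast
  qed
  then obtain w where w: "v \<longlonglongrightarrow> w"
    using Cauchy_convergent convergent_def by blast
  have "(\<lambda>n. J (v n)) \<longlonglongrightarrow> J w"
    unfolding J_def by (intro tendsto_intros w) simp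
  moreover have "(\<lambda>n. m + 1 / real (Suc n)) \<longlonglongrightarrow> m + 0"
    by (intro tendsto_intros LIMSEQ_Suc lim_1_over_n)
  ultimately have "J w \<le> m + 0"
    by (rule LIMSEQ_le) (use v less_imp_le in blast)
  then have Jw: "J w \<le> J x" for x
    using m_le[of x] by simp
  have "f x = w \<bullet> x" for x
  proof -
    define c s where "c = w \<bullet> x - f x" and "s = x \<bullet> x"
    have s: "s \<ge> 0"
      by (simp add: s_def)
    have "0 \<le> t * c + t\<^sup>2 * s / 2" for t
      using Jw[of "w + t *\<^sub>R x"]
      by (simp add: J_def c_def s_def blinfun.bilinear_simps inner_simps inner_commute
          power2_eq_square field_simps)
    moreover define k where "k = c / (s + 1)"
    ultimately have "0 \<le> - k * c + (- k)\<^sup>2 * s / 2"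
      by blast
    moreover have c: "c = k * (s + 1)"
      using s by (simp add: k_def)
    ultimately have "k\<^sup>2 * (s / 2 + 1) \<le> 0"
      unfolding c by (simp add: power2_eq_square algebra_simps)
    then have "k = 0"
      using s mult_pos_pos[of "k\<^sup>2" "s / 2 + 1"] by fastforce
    with c have "c = 0"
      by simp
    then show ?thesis
      by (simp add: c_def)
  qed
  then show ?thesis
    by blast
qed

text \<open>
  The library provides the Banach space \<^typ>\<open>'a \<Rightarrow>\<^sub>L real\<close>. It is copied to a type of its own, so
  that the dual of a Hilbert space can be made an instance of \<^class>\<open>real_inner\<close>. The norm is the
  operator norm.
\<close>

typedef (overloaded) 'a dual = "UNIV :: ('a::real_normed_vector \<Rightarrow>\<^sub>L real) set"
  morphisms functional Dual
  by simp

setup_lifting type_definition_dual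

instantiation dual :: (real_normed_vector) real_normed_vector
begin

lift_definition norm_dual :: "'a dual \<Rightarrow> real" is norm .
lift_definition zero_dual :: "'a dual" is 0 .
lift_definition plus_dual :: "'a dual \<Rightarrow> 'a dual \<Rightarrow> 'a dual" is "(+)" .
lift_definition minus_dual :: "'a dual \<Rightarrow> 'a dual \<Rightarrow> 'a dual" is "(-)" .
lift_definition uminus_dual :: "'a dual \<Rightarrow> 'a dual" is uminus .
lift_definition scaleR_dual :: "real \<Rightarrow> 'a dual \<Rightarrow> 'a dual" is "(*\<^sub>R)" .
definition sgn_dual :: "'a dual \<Rightarrow> 'a dual" where "sgn_dual f = inverse (norm f) *\<^sub>R f"
definition dist_dual :: "'a dual \<Rightarrow> 'a dual \<Rightarrow> real" where "dist_dual f g = norm (f - g)"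
definition [code del]: "(uniformity :: ('a dual \<times> 'a dual) filter) =
  (INF e\<in>{0<..}. principal {(f, g). dist f g < e})"
definition open_dual :: "'a dual set \<Rightarrow> bool" where
  [code del]: "open_dual S = (\<forall>f\<in>S. \<forall>\<^sub>F (f', g) in uniformity. f' = f \<longrightarrow> g \<in> S)"

instance
proof
  fix a b :: real and f g h :: "'a dual"
  show "f + g + h = f + (g + h)" by transfer simp
  show "f + g = g + f" by transfer simp
  show "0 + f = f" by transfer simp
  show "- f + f = 0" by transfer simp
  show "f - g = f + - g" by transfer simp
  show "a *\<^sub>R (f + g) = a *\<^sub>R f + a *\<^sub>R g" by transfer (simp add: algebra_simps)
  show "(a + b) *\<^sub>R f = a *\<^sub>R f + b *\<^sub>R f" by transfer (simp add: algebra_simps)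
  show "a *\<^sub>R b *\<^sub>R f = (a * b) *\<^sub>R f" by transfer simp
  show "1 *\<^sub>R f = f" by transfer simp
  show "sgn f = inverse (norm f) *\<^sub>R f" by (simp add: sgn_dual_def)
  show "dist f g = norm (f - g)" by (simp add: dist_dual_def)
  show "(norm f = 0) = (f = 0)" by transfer simp
  show "norm (f + g) \<le> norm f + norm g" by transfer (rule norm_triangle_ineq)
  show "norm (a *\<^sub>R f) = \<bar>a\<bar> * norm f" by transfer simp
qed (simp_all add: uniformity_dual_def open_dual_def)

end

instance dual :: (real_normed_vector) banach
proof
  fix X :: "nat \<Rightarrow> 'a dual"
  assume "Cauchy X"
  have dist_eq: "dist f g = dist (functional f) (functional g)" for f g :: "'a dual"
    by (simp add: dist_norm norm_dual.rep_eq minus_dual.rep_eq)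
  from \<open>Cauchy X\<close> have "Cauchy (\<lambda>n. functional (X n))"
    by (simp add: Cauchy_def dist_eq)
  then obtain f where "(\<lambda>n. functional (X n)) \<longlonglongrightarrow> f"
    using Cauchy_convergent convergent_def by blast
  then have "X \<longlonglongrightarrow> Dual f"
    by (simp add: tendsto_iff dist_eq Dual_inverse)
  then show "convergent X"
    by (auto simp: convergent_def)
qed

definition pairing :: "'a::real_normed_vector dual \<Rightarrow> 'a \<Rightarrow> real" where
  "pairing f v = blinfun_apply (functional f) v"

lemma pairing_simps [simp]:
  "pairing (f + g) v = pairing f v + pairing g v"
  "pairing (f - g) v = pairing f v - pairing g v"
  "pairing (c *\<^sub>R f) v = c * pairing f v"
  "pairing 0 v = 0"
  "pairing f (v + w) = pairing f v + pairing f w"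
  "pairing f (c *\<^sub>R v) = c * pairing f v"
  "pairing f 0 = 0"
  by (simp_all add: pairing_def plus_dual.rep_eq minus_dual.rep_eq scaleR_dual.rep_eq
      zero_dual.rep_eq blinfun.bilinear_simps)

lemma dual_eqI: "(\<And>v. pairing f v = pairing g v) \<Longrightarrow> f = g"
  by (metis blinfun_eqI functional_inject pairing_def)

lemma pairing_Dual: "pairing (Dual f) v = f v"
  by (simp add: pairing_def Dual_inverse)

lemma norm_pairing_le: "\<bar>pairing f v\<bar> \<le> norm f * norm v"
  using norm_blinfun[of "functional f" v] by (simp add: pairing_def norm_dual.rep_eq)

lemma norm_dual_bound:
  assumes "0 \<le> b" "\<And>v. \<bar>pairing f v\<bar> \<le> b * norm v"
  shows "norm f \<le> b"
  using norm_blinfun_bound[of b "functional f"] assms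
  by (simp add: pairing_def norm_dual.rep_eq)

definition riesz :: "'a::{real_inner,banach} dual \<Rightarrow> 'a" where
  "riesz f = (THE v. \<forall>x. pairing f x = v \<bullet> x)"

lemma pairing_riesz: "pairing f x = riesz f \<bullet> x"
proof -
  have "\<exists>!v. \<forall>x. pairing f x = v \<bullet> x"
    using riesz_representation[of "functional f"]
    by (metis pairing_def vector_eq_rdot)
  from theI'[OF this] show ?thesis
    unfolding riesz_def by blast
qed

lemma riesz_eqI: "(\<And>x. pairing f x = v \<bullet> x) \<Longrightarrow> riesz f = v"
  by (metis pairing_riesz vector_eq_rdot)

lemma riesz_add: "riesz (f + g) = riesz f + riesz g"
  by (rule riesz_eqI) (simp add: inner_add_left flip: pairing_riesz)

lemma riesz_scaleR: "riesz (c *\<^sub>R f) = c *\<^sub>R riesz f"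
  by (rule riesz_eqI) (simp flip: pairing_riesz)

lemma norm_riesz: "norm (riesz f) = norm f"
proof (rule antisym)
  have "norm (riesz f) * norm (riesz f) \<le> norm f * norm (riesz f)"
    using norm_pairing_le[of f "riesz f"]
    by (simp add: pairing_riesz power2_norm_eq_inner flip: power2_eq_square)
  then show "norm (riesz f) \<le> norm f"
    by (cases "riesz f = 0") simp_all
  show "norm f \<le> norm (riesz f)"
    by (rule norm_dual_bound) (simp_all add: pairing_riesz Cauchy_Schwarz_ineq2)
qed

instantiation dual :: ("{real_inner,banach}") real_inner
begin

definition inner_dual :: "'a dual \<Rightarrow> 'a dual \<Rightarrow> real" where
  "inner_dual f g = riesz f \<bullet> riesz g"

instance
proof
  fix f g h :: "'a dual" and c :: real
  show "f \<bullet> g = g \<bullet> f" by (simp add: inner_dual_def inner_commute)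
  show "(f + g) \<bullet> h = f \<bullet> h + g \<bullet> h" by (simp add: inner_dual_def riesz_add inner_add_left)
  show "c *\<^sub>R f \<bullet> g = c * (f \<bullet> g)" by (simp add: inner_dual_def riesz_scaleR)
  show "0 \<le> f \<bullet> f" by (simp add: inner_dual_def)
  show "f \<bullet> f = 0 \<longleftrightarrow> f = 0" by (metis inner_dual_def inner_eq_zero_iff norm_eq_zero norm_riesz)
  show "norm f = sqrt (f \<bullet> f)" by (simp add: inner_dual_def norm_riesz flip: norm_eq_sqrt_inner)
qed

end


section \<open>Hilbert--Schmidt operators\<close>

definition orthonormal_basis :: "'a::real_inner set \<Rightarrow> bool" where
  "orthonormal_basis B \<longleftrightarrow>
     pairwise orthogonal B \<and> (\<forall>e\<in>B. norm e = 1) \<and> closure (span B) = UNIV"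

text \<open>Whether the sum is finite does not depend on the basis, so asking for one basis is enough.\<close>

definition hilbert_schmidt ::
    "('a::{real_inner,banach} \<Rightarrow>\<^sub>L 'b::{real_inner,banach}) \<Rightarrow> bool" where
  "hilbert_schmidt T \<longleftrightarrow>
     (\<exists>B. orthonormal_basis B \<and> (\<lambda>e. (norm (T e))\<^sup>2) summable_on B)"


section \<open>The Gelfand triple\<close>

definition compact_dense_embedding ::
    "('v::real_normed_vector \<Rightarrow>\<^sub>L 'h::real_normed_vector) \<Rightarrow> bool" where
  "compact_dense_embedding \<iota> \<longleftrightarrow>
     inj \<iota> \<and> closure (range \<iota>) = UNIV \<and> (\<forall>S. bounded S \<longrightarrow> compact (closure (\<iota> ` S)))"

text \<open>The embedding of \<open>H\<close>, identified with its dual, into \<open>V*\<close> that comes with \<open>\<iota> : V \<rightarrow> H\<close>.\<close>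

definition to_dual ::
    "('v::real_inner \<Rightarrow>\<^sub>L 'h::real_inner) \<Rightarrow> 'h \<Rightarrow>\<^sub>L 'v dual" where
  "to_dual \<iota> = Blinfun (\<lambda>h. Dual (blinfun_inner_right h o\<^sub>L \<iota>))"

lemma pairing_to_dual: "pairing (to_dual \<iota> h) v = h \<bullet> \<iota> v"
proof -
  have "bounded_linear (\<lambda>h. Dual (blinfun_inner_right h o\<^sub>L \<iota>))"
  proof (rule bounded_linear_intro)
    fix g h and c :: real
    show "Dual (blinfun_inner_right (g + h) o\<^sub>L \<iota>) =
        Dual (blinfun_inner_right g o\<^sub>L \<iota>) + Dual (blinfun_inner_right h o\<^sub>L \<iota>)"
      by (rule dual_eqI) (simp add: pairing_Dual inner_add_left)
    show "Dual (blinfun_inner_right (c *\<^sub>R h) o\<^sub>L \<iota>) = c *\<^sub>R Dual (blinfun_inner_right h o\<^sub>L \<iota>)"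
      by (rule dual_eqI) (simp add: pairing_Dual)
    show "norm (Dual (blinfun_inner_right h o\<^sub>L \<iota>)) \<le> norm h * norm \<iota>"
    proof (rule norm_dual_bound)
      fix v
      have "\<bar>h \<bullet> \<iota> v\<bar> \<le> norm h * norm (\<iota> v)"
        by (rule Cauchy_Schwarz_ineq2)
      also have "\<dots> \<le> norm h * (norm \<iota> * norm v)"
        by (intro mult_left_mono norm_blinfun) simp
      finally show "\<bar>pairing (Dual (blinfun_inner_right h o\<^sub>L \<iota>)) v\<bar> \<le> norm h * norm \<iota> * norm v"
        by (simp add: pairing_Dual mult.assoc)
    qed simp
  qed
  then show ?thesis
    by (simp add: to_dual_def bounded_linear_Blinfun_apply pairing_Dual)
qed

definition dual_op ::
    "('v::real_normed_vector \<Rightarrow>\<^sub>L 'v dual) \<Rightarrow> 'v \<Rightarrow>\<^sub>L 'v dual" where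
  "dual_op A = Blinfun (\<lambda>u. Dual (Blinfun (\<lambda>v. pairing (A v) u)))"

lemma pairing_dual_op: "pairing (dual_op A u) v = pairing (A v) u"
proof -
  have bound: "\<bar>pairing (A v) u\<bar> \<le> norm v * (norm A * norm u)" for u v
  proof -
    have "\<bar>pairing (A v) u\<bar> \<le> norm (A v) * norm u"
      by (rule norm_pairing_le)
    also have "\<dots> \<le> norm A * norm v * norm u"
      by (intro mult_right_mono norm_blinfun) simp
    finally show ?thesis
      by (simp add: mult_ac)
  qed
  have "bounded_linear (\<lambda>v. pairing (A v) u)" for u
    by (rule bounded_linear_intro[where K = "norm A * norm u"])
      (use bound in \<open>simp_all add: blinfun.bilinear_simps\<close>)
  then have inner: "pairing (Dual (Blinfun (\<lambda>v. pairing (A v) u))) v = pairing (A v) u" for u v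
    by (simp add: pairing_Dual bounded_linear_Blinfun_apply)
  have "bounded_linear (\<lambda>u. Dual (Blinfun (\<lambda>v. pairing (A v) u)))"
  proof (rule bounded_linear_intro[where K = "norm A"])
    fix u w and c :: real
    show "Dual (Blinfun (\<lambda>v. pairing (A v) (u + w))) =
        Dual (Blinfun (\<lambda>v. pairing (A v) u)) + Dual (Blinfun (\<lambda>v. pairing (A v) w))"
      by (rule dual_eqI) (unfold pairing_simps(1-3) inner, rule pairing_simps)
    show "Dual (Blinfun (\<lambda>v. pairing (A v) (c *\<^sub>R u))) =
        c *\<^sub>R Dual (Blinfun (\<lambda>v. pairing (A v) u))"
      by (rule dual_eqI) (unfold pairing_simps(1-3) inner, rule pairing_simps)
    show "norm (Dual (Blinfun (\<lambda>v. pairing (A v) u))) \<le> norm u * norm A"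
      by (rule norm_dual_bound) (use bound in \<open>simp_all add: inner mult_ac\<close>)
  qed
  then show ?thesis
    by (simp add: dual_op_def bounded_linear_Blinfun_apply inner)
qed


section \<open>Operator spaces inside the bounded operators from \<open>V\<close> to \<open>V*\<close>\<close>

text \<open>
  The maps \<open>of_X_Y\<close> regard an operator from \<open>X\<close> to \<open>Y\<close>, where \<open>X\<close> and \<open>Y\<close> are members of the Gelfand
  triple (with \<open>V'\<close> for \<open>V*\<close>), as an operator from \<open>V\<close> to \<open>V*\<close>, by composing it with the embeddings
  \<open>\<iota>\<close> and \<open>to_dual \<iota>\<close>.
\<close>

definition of_H_H ::
    "('v::{real_inner,banach} \<Rightarrow>\<^sub>L 'h::{real_inner,banach}) \<Rightarrow> ('h \<Rightarrow>\<^sub>L 'h) \<Rightarrow> 'v \<Rightarrow>\<^sub>L 'v dual" where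
  "of_H_H \<iota> T = to_dual \<iota> o\<^sub>L T o\<^sub>L \<iota>"

definition of_V'_H ::
    "('v::{real_inner,banach} \<Rightarrow>\<^sub>L 'h::{real_inner,banach}) \<Rightarrow> ('v dual \<Rightarrow>\<^sub>L 'h) \<Rightarrow> 'v \<Rightarrow>\<^sub>L 'v dual" where
  "of_V'_H \<iota> T = to_dual \<iota> o\<^sub>L T o\<^sub>L to_dual \<iota> o\<^sub>L \<iota>"

definition of_H_V ::
    "('v::{real_inner,banach} \<Rightarrow>\<^sub>L 'h::{real_inner,banach}) \<Rightarrow> ('h \<Rightarrow>\<^sub>L 'v) \<Rightarrow> 'v \<Rightarrow>\<^sub>L 'v dual" where
  "of_H_V \<iota> T = to_dual \<iota> o\<^sub>L \<iota> o\<^sub>L T o\<^sub>L \<iota>"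

definition of_V_H ::
    "('v::{real_inner,banach} \<Rightarrow>\<^sub>L 'h::{real_inner,banach}) \<Rightarrow> ('v \<Rightarrow>\<^sub>L 'h) \<Rightarrow> 'v \<Rightarrow>\<^sub>L 'v dual" where
  "of_V_H \<iota> T = to_dual \<iota> o\<^sub>L T"

definition of_H_V' ::
    "('v::{real_inner,banach} \<Rightarrow>\<^sub>L 'h::{real_inner,banach}) \<Rightarrow> ('h \<Rightarrow>\<^sub>L 'v dual) \<Rightarrow> 'v \<Rightarrow>\<^sub>L 'v dual" where
  "of_H_V' \<iota> T = T o\<^sub>L \<iota>"

definition HS_V ::
    "('v::{real_inner,banach} \<Rightarrow>\<^sub>L 'h::{real_inner,banach}) \<Rightarrow> ('v \<Rightarrow>\<^sub>L 'v dual) set" where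
  "HS_V \<iota> = of_V'_H \<iota> ` Collect hilbert_schmidt \<inter> of_H_V \<iota> ` Collect hilbert_schmidt"

definition self_adjoint :: "('h::real_inner \<Rightarrow>\<^sub>L 'h) \<Rightarrow> bool" where
  "self_adjoint T \<longleftrightarrow> (\<forall>x y. T x \<bullet> y = x \<bullet> T y)"

definition op_ge :: "('h::real_inner \<Rightarrow>\<^sub>L 'h) \<Rightarrow> real \<Rightarrow> bool" where
  "op_ge T \<beta> \<longleftrightarrow> (\<forall>u. (T - \<beta> *\<^sub>R id_blinfun) u \<bullet> u \<ge> 0)"

text \<open>The argument \<open>\<beta>\<close> is the lower bound itself: the cone \<open>C\<close> with index \<open>-\<beta>\<close> is \<open>HS_cone \<iota> (-\<beta>)\<close>.\<close>

definition HS_cone ::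
    "('v::{real_inner,banach} \<Rightarrow>\<^sub>L 'h::{real_inner,banach}) \<Rightarrow> real \<Rightarrow> ('v \<Rightarrow>\<^sub>L 'v dual) set" where
  "HS_cone \<iota> \<beta> = of_H_H \<iota> ` {T. hilbert_schmidt T \<and> self_adjoint T \<and> op_ge T \<beta>}"

text \<open>
  Conversely, an operator from \<open>V\<close> to \<open>V*\<close> that lies in \<open>L(H,H)\<close>, \<open>L(V*,H)\<close> or \<open>L(H,V)\<close> is turned
  back into an operator between these spaces. By the injectivity lemmas below it is unique.
\<close>

definition as_H_H ::
    "('v::{real_inner,banach} \<Rightarrow>\<^sub>L 'h::{real_inner,banach}) \<Rightarrow> ('v \<Rightarrow>\<^sub>L 'v dual) \<Rightarrow> 'h \<Rightarrow>\<^sub>L 'h" where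
  "as_H_H \<iota> P = (THE T. of_H_H \<iota> T = P)"

definition as_V'_H ::
    "('v::{real_inner,banach} \<Rightarrow>\<^sub>L 'h::{real_inner,banach}) \<Rightarrow> ('v \<Rightarrow>\<^sub>L 'v dual) \<Rightarrow> 'v dual \<Rightarrow>\<^sub>L 'h" where
  "as_V'_H \<iota> P = (THE T. of_V'_H \<iota> T = P)"

definition as_H_V ::
    "('v::{real_inner,banach} \<Rightarrow>\<^sub>L 'h::{real_inner,banach}) \<Rightarrow> ('v \<Rightarrow>\<^sub>L 'v dual) \<Rightarrow> 'h \<Rightarrow>\<^sub>L 'v" where
  "as_H_V \<iota> P = (THE T. of_H_V \<iota> T = P)"

lemma inj_to_dual:
  assumes "closure (range (blinfun_apply \<iota>)) = UNIV"
  shows "inj (to_dual \<iota>)"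
proof (rule injI)
  fix g h assume "to_dual \<iota> g = to_dual \<iota> h"
  then have "(g - h) \<bullet> \<iota> v = 0" for v
    by (simp add: blinfun.diff_right flip: pairing_to_dual)
  then have "range \<iota> \<subseteq> {x. (g - h) \<bullet> x = 0}"
    by auto
  then have "closure (range \<iota>) \<subseteq> {x. (g - h) \<bullet> x = 0}"
    by (intro closure_minimal closed_hyperplane)
  then have "g - h \<in> {x. (g - h) \<bullet> x = 0}"
    unfolding assms by blast
  then show "g = h"
    by simp
qed

lemma blinfun_eq_on_dense:
  fixes S T :: "'a::real_normed_vector \<Rightarrow>\<^sub>L 'b::real_normed_vector"
  assumes "closure D = UNIV" "\<And>x. x \<in> D \<Longrightarrow> S x = T x"
  shows "S = T"
proof (rule blinfun_eqI)
  fix x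
  have "closed {x. S x = T x}"
    by (intro closed_Collect_eq continuous_intros)
  then have "closure D \<subseteq> {x. S x = T x}"
    using assms(2) by (intro closure_minimal) auto
  then show "S x = T x"
    using assms(1) by auto
qed

lemma inj_of_H_H:
  assumes "compact_dense_embedding \<iota>"
  shows "inj (of_H_H \<iota>)"
proof (rule injI)
  fix S T assume eq: "of_H_H \<iota> S = of_H_H \<iota> T"
  have dense: "closure (range \<iota>) = UNIV"
    using assms by (simp add: compact_dense_embedding_def)
  have "S (\<iota> v) = T (\<iota> v)" for v
    using arg_cong[OF eq, of "\<lambda>f. blinfun_apply f v"] inj_to_dual[OF dense]
    by (simp add: of_H_H_def inj_eq)
  with dense show "S = T"
    by (intro blinfun_eq_on_dense[of "range \<iota>"]) auto
qed

lemma inj_of_H_V: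
  assumes "compact_dense_embedding \<iota>"
  shows "inj (of_H_V \<iota>)"
proof (rule injI)
  fix S T assume eq: "of_H_V \<iota> S = of_H_V \<iota> T"
  have "of_H_H \<iota> (\<iota> o\<^sub>L T) = of_H_V \<iota> T" for T
    by (rule blinfun_eqI) (simp add: of_H_H_def of_H_V_def)
  with eq have "of_H_H \<iota> (\<iota> o\<^sub>L S) = of_H_H \<iota> (\<iota> o\<^sub>L T)"
    by simp
  then have "\<iota> o\<^sub>L S = \<iota> o\<^sub>L T"
    using inj_of_H_H[OF assms] by (simp add: inj_eq)
  then have "\<iota> (S x) = \<iota> (T x)" for x
    using blinfun_apply_blinfun_compose[of \<iota>] by metis
  then show "S = T"
    using assms by (auto simp: compact_dense_embedding_def inj_eq intro!: blinfun_eqI)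
qed

lemma inj_of_V'_H:
  assumes "compact_dense_embedding \<iota>"
  shows "inj (of_V'_H \<iota>)"
proof (rule injI)
  fix S T assume eq: "of_V'_H \<iota> S = of_V'_H \<iota> T"
  have dense: "closure (range \<iota>) = UNIV" and inj: "inj \<iota>"
    using assms by (simp_all add: compact_dense_embedding_def)
  have *: "(S - T) (to_dual \<iota> (\<iota> v)) = 0" for v
    using arg_cong[OF eq, of "\<lambda>f. blinfun_apply f v"] inj_to_dual[OF dense]
    by (simp add: of_V'_H_def inj_eq blinfun.bilinear_simps)
  have "(S - T) f = 0" for f
  proof -
    define y where "y = (S - T) f"
    obtain g where g: "\<And>f. (S - T) f \<bullet> y = g \<bullet> f"
      using riesz_representation[of "blinfun_inner_left y o\<^sub>L (S - T)"]
      by (auto simp: blinfun_inner_left.rep_eq)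
    have "\<iota> (riesz g) \<bullet> \<iota> (riesz g) = pairing (to_dual \<iota> (\<iota> (riesz g))) (riesz g)"
      by (simp add: pairing_to_dual)
    also have "\<dots> = g \<bullet> to_dual \<iota> (\<iota> (riesz g))"
      by (simp add: pairing_riesz inner_dual_def inner_commute)
    also have "\<dots> = 0"
      using * by (simp flip: g)
    finally have "\<iota> (riesz g) = \<iota> 0"
      by simp
    then have "g = 0"
      using inj norm_riesz[of g] by (metis injD norm_eq_zero)
    then show ?thesis
      using g[of f] by (simp add: y_def)
  qed
  then show "S = T"
    by (auto simp: blinfun.bilinear_simps intro!: blinfun_eqI)
qed

end

theory Submission
  imports Defs "HOL-Library.Diagonal_Subsequence"
begin

text \<open>
  Write \<open>a(u, v)\<close> for the form of \<open>A\<close>. An operator \<open>T\<close> from \<open>H\<close> to \<open>V\<close>, symmetric in \<open>H\<close>, solves the equation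
  exactly if \<open>a(w, T v) + a(v, T w) + (T v, T w) = (Q v, w)\<close> for all \<open>v\<close>, \<open>w\<close> in \<open>V\<close>. What makes the
  problem well behaved is that the nonlinear map \<open>P \<mapsto> A* P + P A + P\<^sup>2\<close> is strongly monotone on the operators
  \<open>P \<ge> -\<gamma>\<close>: the quadratic term loses at most \<open>2 \<gamma>\<close>, and the linear terms gain at least \<open>2 \<mu>\<^sub>H\<close>.

  Bounded coefficients come first. If \<open>B\<close> is a bounded strongly accretive operator, the Lyapunov equation
  \<open>B* X + X B = R\<close> is solved by a contraction (\<open>lyapunov_solvable\<close>), and \<open>X \<ge> 0\<close> whenever \<open>R \<ge> 0\<close>
  (\<open>lyapunov_nonneg\<close>). Newton's iteration reduces the Riccati equation to Lyapunov equations, and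
  positivity makes the iterates decrease to a solution \<open>P \<ge> -\<gamma>\<close> (\<open>riccati_bounded_solvable\<close>), which is
  unique (\<open>riccati_bounded_unique\<close>).

  The unbounded operator \<open>A\<close> is reached by Galerkin approximation, with vectors of \<open>V\<close> that are orthonormal in
  \<open>H\<close>. Testing the equation with its own solution bounds the Hilbert--Schmidt norm from \<open>H\<close> to \<open>V\<close> of the
  approximate solutions, uniformly in the dimension (\<open>galerkin_solution\<close>). On each basis vector a
  subsequence then converges weakly in \<open>V\<close> and, by the compact embedding, strongly in \<open>H\<close>. This suffices
  for the limit in the equation (\<open>riccati_operator\<close>), since only the quadratic term is nonlinear and it
  involves the inner product of \<open>H\<close> alone. The limit is a Hilbert--Schmidt operator from \<open>H\<close> to \<open>V\<close>; its dual
  is Hilbert--Schmidt from \<open>V*\<close> to \<open>H\<close> (\<open>hilbert_schmidt_dual_adjoint\<close>) and represents the same operator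
  from \<open>V\<close> to \<open>V*\<close> by symmetry.
\<close>


section \<open>Adjoints of bounded operators\<close>

definition adj :: "('a::{real_inner,banach} \<Rightarrow>\<^sub>L 'b::real_inner) \<Rightarrow> 'b \<Rightarrow>\<^sub>L 'a" where
  "adj T = (SOME S :: 'b \<Rightarrow>\<^sub>L 'a. \<forall>x y. T x \<bullet> y = x \<bullet> S y)"

lemma inner_eqI: "(\<And>z. x \<bullet> z = y \<bullet> z) \<Longrightarrow> x = y"
  by (metis vector_eq_rdot)

lemma adj_inner:
  fixes T :: "'a::{real_inner,banach} \<Rightarrow>\<^sub>L 'b::real_inner"
  shows "T x \<bullet> y = x \<bullet> adj T y"
proof -
  have "\<exists>v. \<forall>x. T x \<bullet> y = v \<bullet> x" for y
    using riesz_representation[of "blinfun_inner_left y o\<^sub>L T"]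
    by (simp add: blinfun_inner_left.rep_eq)
  then obtain f where f: "\<And>x y. T x \<bullet> y = f y \<bullet> x"
    by metis
  have "bounded_linear f"
  proof (rule bounded_linear_intro)
    fix x y and c :: real
    show "f (x + y) = f x + f y"
      by (rule inner_eqI) (simp add: inner_simps blinfun.bilinear_simps flip: f)
    show "f (c *\<^sub>R x) = c *\<^sub>R f x"
      by (rule inner_eqI) (simp add: blinfun.bilinear_simps flip: f)
    have "(norm (f x))\<^sup>2 = T (f x) \<bullet> x"
      by (simp add: f power2_norm_eq_inner)
    also have "\<dots> \<le> norm (T (f x)) * norm x"
      by (rule norm_cauchy_schwarz)
    also have "\<dots> \<le> norm T * norm (f x) * norm x"
      by (intro mult_right_mono norm_blinfun) simp
    finally show "norm (f x) \<le> norm x * norm T"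
      by (cases "f x = 0") (simp_all add: power2_eq_square mult_ac)
  qed
  then have "\<forall>x y. T x \<bullet> y = x \<bullet> Blinfun f y"
    using f by (metis inner_commute bounded_linear_Blinfun_apply)
  then have "\<forall>x y. T x \<bullet> y = x \<bullet> adj T y"
    unfolding adj_def by (rule someI)
  then show ?thesis
    by blast
qed

lemma adj_inner':
  fixes T :: "'a::{real_inner,banach} \<Rightarrow>\<^sub>L 'b::real_inner"
  shows "x \<bullet> T y = adj T x \<bullet> y"
  using adj_inner[of T y x] by (simp add: inner_commute)

lemma norm_adj_le:
  fixes T :: "'a::{real_inner,banach} \<Rightarrow>\<^sub>L 'b::real_inner"
  shows "norm (adj T) \<le> norm T"
proof (rule norm_blinfun_bound)
  fix x
  have "(norm (adj T x))\<^sup>2 = T (adj T x) \<bullet> x"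
    by (simp add: adj_inner power2_norm_eq_inner)
  also have "\<dots> \<le> norm (T (adj T x)) * norm x"
    by (rule norm_cauchy_schwarz)
  also have "\<dots> \<le> norm T * norm (adj T x) * norm x"
    by (intro mult_right_mono norm_blinfun) simp
  finally show "norm (adj T x) \<le> norm T * norm x"
    by (cases "adj T x = 0") (simp_all add: power2_eq_square mult_ac)
qed simp


section \<open>The Lyapunov equation\<close>

text \<open>
  The Cauchy--Schwarz inequality of the semi-inner product \<open>(x, y) \<mapsto> D x \<bullet> y\<close>, applied to \<open>x\<close> and \<open>D x\<close>.
  It turns smallness of the number \<open>D x \<bullet> x\<close> into smallness of the vector \<open>D x\<close>; near-minimisers of
  quadratic forms and limits of monotone sequences of operators are both handled in this way.
\<close>

lemma nonneg_op_norm_bound: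
  fixes D :: "'a::real_inner \<Rightarrow>\<^sub>L 'a"
  assumes "self_adjoint D" "\<And>x. 0 \<le> D x \<bullet> x" "\<And>x. D x \<bullet> x \<le> K * (norm x)\<^sup>2"
  shows "(norm (D x))\<^sup>2 \<le> K * (D x \<bullet> x)"
proof -
  define y where "y = D x"
  \<comment> \<open>The form is nonnegative at \<open>x - t y\<close>. The best choice is \<open>t = 1/K\<close>; if \<open>K \<le> 0\<close> the form
    vanishes and \<open>t = 1\<close> will do.\<close>
  have q: "0 \<le> D x \<bullet> x - 2 * t * (norm y)\<^sup>2 + t\<^sup>2 * (K * (norm y)\<^sup>2)" for t
  proof -
    have "D y \<bullet> x = y \<bullet> y" "D x = y"
      using assms(1) by (simp_all add: self_adjoint_def y_def)
    then have "D (x - t *\<^sub>R y) \<bullet> (x - t *\<^sub>R y) =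
        D x \<bullet> x - 2 * t * (norm y)\<^sup>2 + t\<^sup>2 * (D y \<bullet> y)"
      by (simp add: blinfun.bilinear_simps inner_simps
          power2_norm_eq_inner[unfolded power2_eq_square] inner_commute[of x y] power2_eq_square algebra_simps)
    moreover have "t\<^sup>2 * (D y \<bullet> y) \<le> t\<^sup>2 * (K * (norm y)\<^sup>2)"
      by (intro mult_left_mono assms(3)) simp
    ultimately show ?thesis
      using assms(2)[of "x - t *\<^sub>R y"] by linarith
  qed
  show ?thesis
  proof (cases "K > 0")
    case True
    have "0 \<le> D x \<bullet> x - (norm y)\<^sup>2 / K"
      using q[of "1/K"] True by (simp add: power2_eq_square field_simps)
    then show ?thesis
      using True by (simp add: y_def field_simps)
  next
    case False
    then have K: "K * (norm z)\<^sup>2 \<le> 0" for z :: 'a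
      by (simp add: mult_nonpos_nonneg)
    have 0: "D x \<bullet> x = 0"
      using assms(2,3)[of x] K[of x] by linarith
    have "0 \<le> - 2 * (norm y)\<^sup>2 + K * (norm y)\<^sup>2"
      using q[of 1] by (simp add: 0)
    with K[of y] have "(norm y)\<^sup>2 \<le> 0"
      by linarith
    then show ?thesis
      by (simp add: 0 y_def)
  qed
qed

lemma inner_op_le_norm:
  fixes T :: "'a::real_normed_vector \<Rightarrow>\<^sub>L 'b::real_inner"
  shows "T x \<bullet> y \<le> norm T * norm x * norm y"
proof -
  have "T x \<bullet> y \<le> norm (T x) * norm y"
    by (rule norm_cauchy_schwarz)
  also have "\<dots> \<le> norm T * norm x * norm y"
    by (intro mult_right_mono norm_blinfun) simp
  finally show ?thesis .
qed

lemma abs_inner_op_le_norm: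
  fixes T :: "'a::real_normed_vector \<Rightarrow>\<^sub>L 'b::real_inner"
  shows "\<bar>T x \<bullet> y\<bar> \<le> norm T * norm x * norm y"
  using inner_op_le_norm[of T x y] inner_op_le_norm[of T x "- y"] by simp

text \<open>
  If \<open>B* S + S B \<ge> 0\<close> and \<open>B\<close> is strongly accretive, then \<open>S \<ge> 0\<close>. In finite dimensions one takes a unit
  eigenvector \<open>y\<close> for the least eigenvalue \<open>l\<close> of \<open>S\<close> and finds \<open>S y \<bullet> B y = l * (y \<bullet> B y)\<close>, so that \<open>l < 0\<close>
  is impossible. In general \<open>l\<close> is the infimum of the Rayleigh quotient, and near-minimisers are
  approximate eigenvectors by \<open>nonneg_op_norm_bound\<close>.
\<close>

lemma lyapunov_nonneg:
  fixes B S :: "'a::real_inner \<Rightarrow>\<^sub>L 'a"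
  assumes \<mu>: "0 < \<mu>" "\<And>x. \<mu> * (norm x)\<^sup>2 \<le> B x \<bullet> x"
    and S: "self_adjoint S"
    and SB: "\<And>x. 0 \<le> S x \<bullet> B x"
  shows "0 \<le> S x \<bullet> x"
proof (rule ccontr)
  assume neg: "\<not> 0 \<le> S x \<bullet> x"
  define R where "R = {S x \<bullet> x | x. norm x = 1}"
  define l where "l = Inf R"
  have bdd: "bdd_below R"
    unfolding R_def
  proof (rule bdd_belowI)
    fix r assume "r \<in> {S x \<bullet> x | x. norm x = 1}"
    then obtain x where "r = S x \<bullet> x" "norm x = 1"
      by blast
    then show "- norm S \<le> r"
      using abs_inner_op_le_norm[of S x x] by simp
  qed
  have scale: "S y \<bullet> y = (norm y)\<^sup>2 * (S (y /\<^sub>R norm y) \<bullet> (y /\<^sub>R norm y))" for y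
    by (cases "y = 0") (simp_all add: blinfun.scaleR_right power2_eq_square field_simps)
  have l_le: "l * (norm y)\<^sup>2 \<le> S y \<bullet> y" for y
  proof (cases "y = 0")
    case False
    then have "l \<le> S (y /\<^sub>R norm y) \<bullet> (y /\<^sub>R norm y)"
      unfolding l_def by (intro cInf_lower bdd) (auto simp: R_def intro!: exI[of _ "y /\<^sub>R norm y"])
    then have "(norm y)\<^sup>2 * l \<le> (norm y)\<^sup>2 * (S (y /\<^sub>R norm y) \<bullet> (y /\<^sub>R norm y))"
      by (rule mult_left_mono) simp
    then show ?thesis
      unfolding scale[symmetric] by (simp add: mult.commute)
  qed simp
  have "l < 0"
  proof (rule ccontr)
    assume "\<not> l < 0"
    then have "0 \<le> l * (norm x)\<^sup>2"
      by simp
    with neg l_le[of x] show False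
      by linarith
  qed
  have "x \<noteq> 0"
    using neg by auto
  then have ne: "R \<noteq> {}"
    unfolding R_def by (auto intro: exI[of _ "x /\<^sub>R norm x"])
  define D where "D = S - l *\<^sub>R id_blinfun"
  define K where "K = norm S - l"
  have D_apply: "D y = S y - l *\<^sub>R y" for y
    by (simp add: D_def blinfun.bilinear_simps)
  have "K > 0"
    using \<open>l < 0\<close> norm_ge_zero[of S] unfolding K_def by linarith
  have D: "(norm (D y))\<^sup>2 \<le> K * (D y \<bullet> y)" for y
  proof (rule nonneg_op_norm_bound)
    show "self_adjoint D"
      using S by (simp add: self_adjoint_def D_apply inner_simps)
    show "0 \<le> D y \<bullet> y" for y
      using l_le[of y] by (simp add: D_apply inner_simps power2_norm_eq_inner)
    show "D y \<bullet> y \<le> K * (norm y)\<^sup>2" for y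
      using inner_op_le_norm[of S y y]
      by (simp add: D_apply K_def inner_simps power2_norm_eq_inner[symmetric]
          power2_eq_square algebra_simps)
  qed
  define b where "b = norm B + 1"
  have b: "b > 0"
    using norm_ge_zero[of B] unfolding b_def by linarith
  \<comment> \<open>Chosen such that a unit vector \<open>y\<close> with \<open>S y \<bullet> y < l + \<epsilon>\<close> satisfies \<open>norm B * norm (D y) < - l * \<mu>\<close>.\<close>
  define \<epsilon> where "\<epsilon> = (l * \<mu> / b)\<^sup>2 / K"
  have "\<epsilon> > 0"
    using \<open>K > 0\<close> \<open>l < 0\<close> \<mu> b by (simp add: \<epsilon>_def)
  then have "\<exists>r\<in>R. r < l + \<epsilon>"
    using cInf_lessD[OF ne, of "l + \<epsilon>"] by (simp add: l_def)
  then obtain y where y: "norm y = 1" "S y \<bullet> y < l + \<epsilon>"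
    by (auto simp: R_def)
  have "D y \<bullet> y < \<epsilon>"
    using y by (simp add: D_apply inner_simps power2_norm_eq_inner[symmetric])
  then have "K * (D y \<bullet> y) < K * \<epsilon>"
    using \<open>K > 0\<close> by simp
  with D[of y] have "(norm (D y))\<^sup>2 < (- (l * \<mu> / b))\<^sup>2"
    using \<open>K > 0\<close> by (simp add: \<epsilon>_def)
  then have "norm (D y) < - (l * \<mu> / b)"
    by (rule power_less_imp_less_base) (use \<open>l < 0\<close> \<mu> b in \<open>simp add: mult_nonpos_nonneg divide_nonpos_pos\<close>)
  then have "norm (D y) * b < - (l * \<mu>)"
    using b by (simp add: field_simps)
  moreover have "B y \<bullet> D y \<le> norm (D y) * b"
  proof -
    have "B y \<bullet> D y \<le> norm B * norm (D y)"
      using inner_op_le_norm[of B y "D y"] y by simp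
    also have "\<dots> \<le> norm (D y) * b"
      by (simp add: b_def algebra_simps)
    finally show ?thesis .
  qed
  moreover have "l * (B y \<bullet> y) \<le> l * \<mu>"
    using \<mu>(2)[of y] y \<open>l < 0\<close> by simp
  moreover have "S y \<bullet> B y = l * (B y \<bullet> y) + B y \<bullet> D y"
    by (simp add: D_apply inner_simps inner_commute)
  ultimately show False
    using SB[of y] by linarith
qed

lemma self_adjoint_eq_0I:
  fixes D :: "'a::real_inner \<Rightarrow>\<^sub>L 'a"
  assumes "self_adjoint D" "\<And>x. D x \<bullet> x = 0"
  shows "D = 0"
proof (rule blinfun_eqI)
  fix x
  have "(norm (D x))\<^sup>2 \<le> 0 * (D x \<bullet> x)"
    by (rule nonneg_op_norm_bound) (use assms in auto)
  then show "D x = blinfun_apply 0 x"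
    by simp
qed

lemma self_adjoint_arith:
  "self_adjoint S \<Longrightarrow> self_adjoint T \<Longrightarrow> self_adjoint (S + T)"
  "self_adjoint S \<Longrightarrow> self_adjoint T \<Longrightarrow> self_adjoint (S - T)"
  "self_adjoint S \<Longrightarrow> self_adjoint (- S)"
  "self_adjoint S \<Longrightarrow> self_adjoint (c *\<^sub>R S)"
  "self_adjoint id_blinfun"
  "self_adjoint 0"
  by (simp_all add: self_adjoint_def blinfun.bilinear_simps inner_simps)

lemma lyapunov_unique:
  fixes B S :: "'a::real_inner \<Rightarrow>\<^sub>L 'a"
  assumes \<mu>: "0 < \<mu>" "\<And>x. \<mu> * (norm x)\<^sup>2 \<le> B x \<bullet> x"
    and S: "self_adjoint S"
    and SB: "\<And>x. S x \<bullet> B x = 0"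
  shows "S = 0"
proof (rule self_adjoint_eq_0I[OF S])
  fix x
  have "0 \<le> S x \<bullet> x"
    by (rule lyapunov_nonneg[OF \<mu> S]) (simp add: SB)
  moreover have "0 \<le> (- S) x \<bullet> x"
    by (rule lyapunov_nonneg[OF \<mu>]) (simp_all add: SB S self_adjoint_arith blinfun.bilinear_simps)
  ultimately show "S x \<bullet> x = 0"
    by (simp add: blinfun.bilinear_simps)
qed

text \<open>
  With \<open>N = 1 - 2 \<tau> B\<close> the relaxation \<open>X \<mapsto> X - \<tau> (B* X + X B - R)\<close> has the linear part
  \<open>X \<mapsto> (N* X + X N) / 2\<close>. Since \<open>B\<close> is bounded and strongly accretive, \<open>norm N < 1\<close> for small \<open>\<tau>\<close>, so this
  is a contraction of the Banach space of bounded operators. Its fixed point is self-adjoint because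
  its adjoint is a fixed point too.
\<close>

lemma lyapunov_solvable:
  fixes B R :: "'a::{real_inner,banach} \<Rightarrow>\<^sub>L 'a"
  assumes \<mu>: "0 < \<mu>" "\<And>x. \<mu> * (norm x)\<^sup>2 \<le> B x \<bullet> x"
    and R: "self_adjoint R"
  shows "\<exists>X. self_adjoint X \<and> (\<forall>x y. X x \<bullet> B y + B x \<bullet> X y = R x \<bullet> y)"
proof -
  define K where "K = norm B + \<mu>"
  have K: "\<mu> \<le> K" "norm B \<le> K" "K > 0"
    using \<mu>(1) norm_ge_zero[of B] unfolding K_def by linarith+
  \<comment> \<open>This \<open>\<tau>\<close> minimises the bound \<open>1 - 4 \<tau> \<mu> + 4 \<tau>\<^sup>2 K\<^sup>2\<close> of \<open>(norm N)\<^sup>2\<close>; the minimum is \<open>c\<^sup>2\<close> below.\<close>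
  define \<tau> where "\<tau> = \<mu> / (2 * K\<^sup>2)"
  define c where "c = sqrt (1 - (\<mu> / K)\<^sup>2)"
  have "(\<mu> / K)\<^sup>2 \<le> 1"
    using K \<mu>(1) by (simp add: power_le_one)
  moreover have "0 < (\<mu> / K)\<^sup>2"
    using K \<mu> by simp
  ultimately have c: "0 \<le> c" "c < 1" and c2: "c\<^sup>2 = 1 - (\<mu> / K)\<^sup>2"
    by (simp_all add: c_def)
  define N where "N = id_blinfun - (2 * \<tau>) *\<^sub>R B"
  have N_apply: "N x = x - (2 * \<tau>) *\<^sub>R B x" for x
    by (simp add: N_def blinfun.bilinear_simps)
  have norm_N: "norm N \<le> c"
  proof (rule norm_blinfun_bound[OF c(1)])
    fix x
    have "norm (B x) \<le> K * norm x"
      using norm_blinfun[of B x] K(2) by (meson mult_right_mono norm_ge_zero order_trans)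
    then have Bx: "(norm (B x))\<^sup>2 \<le> K\<^sup>2 * (norm x)\<^sup>2"
      using power_mono[of "norm (B x)" "K * norm x" 2] by (simp add: power_mult_distrib)
    have "(norm (N x))\<^sup>2 = (norm x)\<^sup>2 - 4 * \<tau> * (B x \<bullet> x) + 4 * \<tau>\<^sup>2 * (norm (B x))\<^sup>2"
      unfolding N_apply power2_norm_eq_inner
      by (simp add: inner_simps inner_commute power2_eq_square algebra_simps)
    also have "\<dots> \<le> (norm x)\<^sup>2 - 4 * \<tau> * (\<mu> * (norm x)\<^sup>2) + 4 * \<tau>\<^sup>2 * (K\<^sup>2 * (norm x)\<^sup>2)"
      using \<mu> K Bx by (intro add_mono diff_mono mult_left_mono) (simp_all add: \<tau>_def)
    also have "\<dots> = c\<^sup>2 * (norm x)\<^sup>2"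
      using K(3) unfolding c2 \<tau>_def by (simp add: power2_eq_square field_simps)
    finally have "(norm (N x))\<^sup>2 \<le> (c * norm x)\<^sup>2"
      by (simp add: power_mult_distrib)
    then show "norm (N x) \<le> c * norm x"
      by (rule power2_le_imp_le) (simp add: c)
  qed
  define \<Phi> where "\<Phi> X = X - \<tau> *\<^sub>R ((adj B o\<^sub>L X) + (X o\<^sub>L B) - R)" for X
  have adjN: "adj N x = x - (2 * \<tau>) *\<^sub>R adj B x" for x
    by (rule inner_eqI) (simp add: inner_simps N_apply flip: adj_inner')
  have "\<Phi> X - \<Phi> Y = (1/2) *\<^sub>R ((adj N o\<^sub>L (X - Y)) + ((X - Y) o\<^sub>L N))" for X Y
  proof (rule blinfun_eqI)
    fix x
    have "(\<Phi> X - \<Phi> Y) x =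
        (X - Y) x - \<tau> *\<^sub>R adj B ((X - Y) x) - \<tau> *\<^sub>R (X - Y) (B x)"
      by (simp add: \<Phi>_def blinfun.bilinear_simps algebra_simps)
    also have "\<dots> = (1/2) *\<^sub>R ((X - Y) x + (X - Y) x) - \<tau> *\<^sub>R adj B ((X - Y) x) - \<tau> *\<^sub>R (X - Y) (B x)"
      by (simp add: scaleR_2[symmetric])
    also have "\<dots> = ((1/2) *\<^sub>R ((adj N o\<^sub>L (X - Y)) + ((X - Y) o\<^sub>L N))) x"
      by (simp add: adjN N_apply blinfun.bilinear_simps algebra_simps)
    finally show "(\<Phi> X - \<Phi> Y) x = ((1/2) *\<^sub>R ((adj N o\<^sub>L (X - Y)) + ((X - Y) o\<^sub>L N))) x" .
  qed
  moreover have "norm ((1/2) *\<^sub>R ((adj N o\<^sub>L D) + (D o\<^sub>L N))) \<le> c * norm D" for D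
  proof -
    have "norm (adj N o\<^sub>L D) \<le> c * norm D"
      by (rule order_trans[OF norm_blinfun_compose])
        (use norm_adj_le[of N] norm_N in \<open>simp add: mult_right_mono\<close>)
    moreover have "norm (D o\<^sub>L N) \<le> c * norm D"
      by (rule order_trans[OF norm_blinfun_compose])
        (use mult_left_mono[OF norm_N norm_ge_zero[of D]] in \<open>simp add: mult.commute\<close>)
    ultimately show ?thesis
      using norm_triangle_ineq[of "adj N o\<^sub>L D" "D o\<^sub>L N"] by simp
  qed
  ultimately have "dist (\<Phi> X) (\<Phi> Y) \<le> c * dist X Y" for X Y
    by (simp add: dist_norm)
  then have ex1: "\<exists>!X. \<Phi> X = X"
    using banach_fix_type[OF c, of \<Phi>] by blast
  then obtain X where X: "\<Phi> X = X"
    by blast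
  have \<tau>: "\<tau> > 0"
    using \<mu> K by (simp add: \<tau>_def)
  have fix_iff: "\<Phi> X = X \<longleftrightarrow> (\<forall>x y. X x \<bullet> B y + X (B x) \<bullet> y = R x \<bullet> y)" for X
  proof -
    have "\<Phi> X = X \<longleftrightarrow> (adj B o\<^sub>L X) + (X o\<^sub>L B) = R"
      using \<tau> by (simp add: \<Phi>_def)
    also have "\<dots> \<longleftrightarrow> (\<forall>x y. ((adj B o\<^sub>L X) + (X o\<^sub>L B)) x \<bullet> y = R x \<bullet> y)"
      by (metis blinfun_eqI vector_eq_rdot)
    finally show ?thesis
      by (simp add: blinfun.bilinear_simps inner_simps adj_inner')
  qed
  have "\<Phi> (adj X) = adj X"
    unfolding fix_iff
  proof (intro allI)
    fix x y
    have "adj X x \<bullet> B y + adj X (B x) \<bullet> y = X y \<bullet> B x + X (B y) \<bullet> x"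
      by (metis adj_inner inner_commute add.commute)
    also have "\<dots> = R y \<bullet> x"
      using X by (simp add: fix_iff)
    finally show "adj X x \<bullet> B y + adj X (B x) \<bullet> y = R x \<bullet> y"
      using R by (simp add: self_adjoint_def inner_commute)
  qed
  with X ex1 have "adj X = X"
    by blast
  then have sa: "self_adjoint X"
    unfolding self_adjoint_def by (metis adj_inner)
  with X show ?thesis
    unfolding fix_iff by (intro exI[of _ X]) (simp add: self_adjoint_def)
qed


section \<open>The Riccati equation with bounded coefficients\<close>

text \<open>
  Vigier's theorem: for \<open>k \<le> l\<close> the difference \<open>Y k - Y l\<close> lies between \<open>0\<close> and \<open>norm (Y 0)\<close>, so
  \<open>nonneg_op_norm_bound\<close> bounds \<open>norm (Y k x - Y l x)\<close> by the corresponding difference of the convergent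
  numbers \<open>Y k x \<bullet> x\<close>.
\<close>

lemma decreasing_nonneg_op_limit:
  fixes Y :: "nat \<Rightarrow> 'a::{real_inner,banach} \<Rightarrow>\<^sub>L 'a"
  assumes sa: "\<And>k. self_adjoint (Y k)"
    and nonneg: "\<And>k x. 0 \<le> Y k x \<bullet> x"
    and dec: "\<And>k x. Y (Suc k) x \<bullet> x \<le> Y k x \<bullet> x"
  obtains S where "self_adjoint S" "\<And>x. (\<lambda>k. Y k x) \<longlonglongrightarrow> S x"
proof -
  define K where "K = norm (Y 0)"
  have decx: "decseq (\<lambda>k. Y k x \<bullet> x)" for x
    using dec by (simp add: decseq_Suc_iff)
  have le_K: "Y k x \<bullet> x \<le> K * (norm x)\<^sup>2" for k x
    using decseqD[OF decx, of 0 k x] inner_op_le_norm[of "Y 0" x x]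
    by (simp add: K_def power2_eq_square mult.assoc)
  have bound: "norm (Y k x) \<le> norm x * K" for k x
  proof -
    have "(norm (Y k x))\<^sup>2 \<le> K * (Y k x \<bullet> x)"
      by (rule nonneg_op_norm_bound[OF sa nonneg le_K])
    also have "\<dots> \<le> K * (K * (norm x)\<^sup>2)"
      by (intro mult_left_mono le_K) (simp add: K_def)
    finally have "(norm (Y k x))\<^sup>2 \<le> (norm x * K)\<^sup>2"
      by (simp add: power2_eq_square mult_ac)
    then show ?thesis
      by (rule power2_le_imp_le) (simp add: K_def)
  qed
  have diff: "(norm (Y k x - Y l x))\<^sup>2 \<le> K * (Y k x \<bullet> x - Y l x \<bullet> x)" if "k \<le> l" for k l x
  proof -
    have "(norm ((Y k - Y l) x))\<^sup>2 \<le> K * ((Y k - Y l) x \<bullet> x)"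
    proof (rule nonneg_op_norm_bound)
      show "self_adjoint (Y k - Y l)"
        by (intro self_adjoint_arith sa)
      show "0 \<le> (Y k - Y l) y \<bullet> y" for y
        using decseqD[OF decx that, of y] by (simp add: blinfun.bilinear_simps inner_simps)
      show "(Y k - Y l) y \<bullet> y \<le> K * (norm y)\<^sup>2" for y
        using le_K[of k y] nonneg[of l y] by (simp add: blinfun.bilinear_simps inner_simps)
    qed
    then show ?thesis
      by (simp add: blinfun.bilinear_simps inner_simps)
  qed
  have "Cauchy (\<lambda>k. Y k x)" for x
  proof (rule metric_CauchyI)
    fix e :: real assume "0 < e"
    have K1: "K + 1 > 0"
      using norm_ge_zero[of "Y 0"] unfolding K_def by linarith
    have "convergent (\<lambda>k. Y k x \<bullet> x)"
      by (rule decseq_convergent[OF decx, of 0]) (use nonneg in \<open>auto simp: convergent_def\<close>)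
    then have "Cauchy (\<lambda>k. Y k x \<bullet> x)"
      by (rule convergent_Cauchy)
    moreover have "0 < e\<^sup>2 / (K + 1)"
      using \<open>0 < e\<close> K1 by simp
    ultimately obtain M where
      M: "\<And>k l. M \<le> k \<Longrightarrow> M \<le> l \<Longrightarrow> dist (Y k x \<bullet> x) (Y l x \<bullet> x) < e\<^sup>2 / (K + 1)"
      unfolding Cauchy_def by meson
    have *: "dist (Y k x) (Y l x) < e" if "M \<le> k" "k \<le> l" for k l
    proof -
      define t where "t = Y k x \<bullet> x - Y l x \<bullet> x"
      have t: "0 \<le> t" "t < e\<^sup>2 / (K + 1)"
        using decseqD[OF decx that(2), of x] M[of k l] that by (auto simp: t_def dist_norm)
      have "(norm (Y k x - Y l x))\<^sup>2 \<le> K * t"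
        unfolding t_def by (rule diff[OF that(2)])
      also have "\<dots> \<le> (K + 1) * t"
        using t(1) by (simp add: algebra_simps)
      also have "\<dots> < e\<^sup>2"
        using t(2) K1 by (simp add: field_simps)
      finally show ?thesis
        using \<open>0 < e\<close> by (simp add: dist_norm power_less_imp_less_base)
    qed
    have "dist (Y k x) (Y l x) < e" if "M \<le> k" "M \<le> l" for k l
      using *[of k l] *[of l k] that by (metis dist_commute nat_le_linear)
    then show "\<exists>M. \<forall>k\<ge>M. \<forall>l\<ge>M. dist (Y k x) (Y l x) < e"
      by blast
  qed
  then have "\<exists>s. (\<lambda>k. Y k x) \<longlonglongrightarrow> s" for x
    using Cauchy_convergent convergent_def by blast
  then obtain s where s: "\<And>x. (\<lambda>k. Y k x) \<longlonglongrightarrow> s x"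
    by metis
  have "bounded_linear s"
  proof (rule bounded_linear_intro)
    fix x y and c :: real
    show "s (x + y) = s x + s y"
      using tendsto_add[OF s[of x] s[of y]] s[of "x + y"] LIMSEQ_unique
      by (simp add: blinfun.bilinear_simps) blast
    show "s (c *\<^sub>R x) = c *\<^sub>R s x"
      using tendsto_scaleR[OF tendsto_const s[of x], of c] s[of "c *\<^sub>R x"] LIMSEQ_unique
      by (simp add: blinfun.bilinear_simps) blast
    show "norm (s x) \<le> norm x * K"
      by (rule tendsto_upperbound[OF tendsto_norm[OF s]]) (simp_all add: bound)
  qed
  then have S: "blinfun_apply (Blinfun s) = s"
    by (rule bounded_linear_Blinfun_apply)
  have "s x \<bullet> y = x \<bullet> s y" for x y
  proof (rule LIMSEQ_unique)
    show "(\<lambda>k. Y k x \<bullet> y) \<longlonglongrightarrow> s x \<bullet> y"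
      by (intro tendsto_intros s)
    have "(\<lambda>k. x \<bullet> Y k y) \<longlonglongrightarrow> x \<bullet> s y"
      by (intro tendsto_intros s)
    then show "(\<lambda>k. Y k x \<bullet> y) \<longlonglongrightarrow> x \<bullet> s y"
      using sa by (simp add: self_adjoint_def)
  qed
  then have "self_adjoint (Blinfun s)"
    by (simp add: self_adjoint_def S)
  then show thesis
    by (rule that) (simp add: S s)
qed

text \<open>
  The Newton--Kleinman iteration: given \<open>X\<close>, the next iterate \<open>Y\<close> solves the Lyapunov equation
  \<open>(B + X)* Y + Y (B + X) = Q + X\<^sup>2\<close>. All iterates are nonnegative, so that \<open>B + X\<close> stays strongly
  accretive. From the second one on they decrease, since the difference \<open>D\<close> of successive iterates
  \<open>X'\<close>, \<open>X''\<close> that follow \<open>X\<close> satisfies \<open>(B + X')* D + D (B + X') = (X - X')\<^sup>2\<close>. The strong limit solves the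
  equation.
\<close>

lemma riccati_nonneg_solvable:
  fixes B Q :: "'a::{real_inner,banach} \<Rightarrow>\<^sub>L 'a"
  assumes \<mu>: "0 < \<mu>" "\<And>x. \<mu> * (norm x)\<^sup>2 \<le> B x \<bullet> x"
    and Q: "self_adjoint Q" "\<And>x. 0 \<le> Q x \<bullet> x"
  obtains S where "self_adjoint S" "\<And>x. 0 \<le> S x \<bullet> x"
    "\<And>x y. S x \<bullet> B y + B x \<bullet> S y + S x \<bullet> S y = Q x \<bullet> y"
proof -
  define N where "N X Y \<longleftrightarrow>
      (\<forall>x y. Y x \<bullet> (B + X) y + (B + X) x \<bullet> Y y = Q x \<bullet> y + X x \<bullet> X y)" for X Y
  define pos where "pos X \<longleftrightarrow> self_adjoint X \<and> (\<forall>x. 0 \<le> X x \<bullet> x)" for X :: "'a \<Rightarrow>\<^sub>L 'a"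
  have acc: "\<mu> * (norm x)\<^sup>2 \<le> (B + X) x \<bullet> x" if "pos X" for X x
    using \<mu>(2)[of x] that by (simp add: pos_def blinfun.bilinear_simps inner_simps add_increasing2)
  have step: "\<exists>Y. pos Y \<and> N X Y" if X: "pos X" for X
  proof -
    have sa: "self_adjoint (Q + (X o\<^sub>L X))"
      using X Q by (simp add: pos_def self_adjoint_def blinfun.bilinear_simps inner_simps)
    obtain Y where Y: "self_adjoint Y"
      "\<And>x y. Y x \<bullet> (B + X) y + (B + X) x \<bullet> Y y = (Q + (X o\<^sub>L X)) x \<bullet> y"
      using lyapunov_solvable[OF \<mu>(1) acc[OF X] sa] by blast
    have N: "N X Y"
      using Y(2) X by (simp add: N_def pos_def self_adjoint_def blinfun.bilinear_simps inner_simps)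
    have "0 \<le> Y x \<bullet> (B + X) x" for x
    proof -
      have "Y x \<bullet> (B + X) x + Y x \<bullet> (B + X) x = Q x \<bullet> x + X x \<bullet> X x"
        using N by (metis N_def inner_commute)
      then show ?thesis
        using Q(2)[of x] inner_ge_zero[of "X x"] by linarith
    qed
    then have "0 \<le> Y x \<bullet> x" for x
      by (rule lyapunov_nonneg[OF \<mu>(1) acc[OF X] Y(1)])
    with Y(1) N show ?thesis
      by (auto simp: pos_def)
  qed
  have "pos 0"
    by (simp add: pos_def self_adjoint_arith)
  then obtain X where X: "\<And>n. pos (X n)" "\<And>n. N (X n) (X (Suc n))"
    using dependent_nat_choice[of "\<lambda>_. pos" "\<lambda>_. N"] step by blast
  have dec: "X (Suc (Suc n)) x \<bullet> x \<le> X (Suc n) x \<bullet> x" for n x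
  proof -
    define D where "D = X (Suc n) - X (Suc (Suc n))"
    have "0 \<le> D x \<bullet> x"
    proof (rule lyapunov_nonneg[OF \<mu>(1) acc[OF X(1)]])
      show "self_adjoint D"
        using X(1) unfolding D_def pos_def by (blast intro: self_adjoint_arith)
      fix x
      have "X (Suc n) x \<bullet> (B + X n) x + (B + X n) x \<bullet> X (Suc n) x
          = Q x \<bullet> x + X n x \<bullet> X n x"
        using X(2)[of n] by (simp add: N_def)
      moreover have "X (Suc (Suc n)) x \<bullet> (B + X (Suc n)) x + (B + X (Suc n)) x \<bullet> X (Suc (Suc n)) x
          = Q x \<bullet> x + X (Suc n) x \<bullet> X (Suc n) x"
        using X(2)[of "Suc n"] by (simp add: N_def)
      ultimately have "2 * (D x \<bullet> (B + X (Suc n)) x) =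
          (X n x - X (Suc n) x) \<bullet> (X n x - X (Suc n) x)"
        by (simp add: D_def blinfun.bilinear_simps inner_simps inner_commute)
      then show "0 \<le> D x \<bullet> (B + X (Suc n)) x"
        using inner_ge_zero[of "X n x - X (Suc n) x"] by linarith
    qed
    then show ?thesis
      by (simp add: D_def blinfun.bilinear_simps inner_simps)
  qed
  obtain S where S: "self_adjoint S" "\<And>x. (\<lambda>k. X (Suc k) x) \<longlonglongrightarrow> S x"
    using decreasing_nonneg_op_limit[of "\<lambda>k. X (Suc k)"] X(1) dec unfolding pos_def by blast
  have S': "(\<lambda>k. X k x) \<longlonglongrightarrow> S x" for x
    using S(2)[of x] by (rule LIMSEQ_imp_Suc)
  show thesis
  proof (rule that[OF S(1)])
    show "0 \<le> S x \<bullet> x" for x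
      by (rule tendsto_lowerbound[OF tendsto_inner[OF S' tendsto_const]])
        (use X(1) in \<open>auto simp: pos_def\<close>)
    fix x y
    have "S x \<bullet> (B y + S y) + (B x + S x) \<bullet> S y = Q x \<bullet> y + S x \<bullet> S y"
    proof (rule LIMSEQ_unique)
      show "(\<lambda>k. Q x \<bullet> y + X k x \<bullet> X k y) \<longlonglongrightarrow> Q x \<bullet> y + S x \<bullet> S y"
        by (intro tendsto_intros S')
      have "(\<lambda>k. X (Suc k) x \<bullet> (B y + X k y) + (B x + X k x) \<bullet> X (Suc k) y)
          \<longlonglongrightarrow> S x \<bullet> (B y + S y) + (B x + S x) \<bullet> S y"
        by (intro tendsto_intros S(2) S')
      then show "(\<lambda>k. Q x \<bullet> y + X k x \<bullet> X k y)
          \<longlonglongrightarrow> S x \<bullet> (B y + S y) + (B x + S x) \<bullet> S y"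
        using X(2) by (simp add: N_def blinfun.bilinear_simps)
    qed
    then show "S x \<bullet> B y + B x \<bullet> S y + S x \<bullet> S y = Q x \<bullet> y"
      by (simp add: inner_simps)
  qed
qed

text \<open>
  The substitution \<open>P = S - \<gamma>\<close> turns the equation into the same one for \<open>B - \<gamma>\<close> and
  \<open>Q - \<gamma>\<^sup>2 + \<gamma> (B + B*)\<close>. This right-hand side is at least \<open>2 \<gamma> (\<mu> - \<gamma>) \<ge> 0\<close>.
\<close>

lemma riccati_bounded_solvable:
  fixes B Q :: "'a::{real_inner,banach} \<Rightarrow>\<^sub>L 'a"
  assumes \<mu>: "0 \<le> \<gamma>" "\<gamma> < \<mu>" "\<And>x. \<mu> * (norm x)\<^sup>2 \<le> B x \<bullet> x"
    and Q: "self_adjoint Q" "\<And>x. - \<gamma>\<^sup>2 * (norm x)\<^sup>2 \<le> Q x \<bullet> x"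
  obtains P where "self_adjoint P" "\<And>x. - \<gamma> * (norm x)\<^sup>2 \<le> P x \<bullet> x"
    "\<And>x y. P x \<bullet> B y + B x \<bullet> P y + P x \<bullet> P y = Q x \<bullet> y"
proof -
  define B' where "B' = B - \<gamma> *\<^sub>R id_blinfun"
  define Q' where "Q' = Q - \<gamma>\<^sup>2 *\<^sub>R id_blinfun + \<gamma> *\<^sub>R (B + adj B)"
  have B': "B' x = B x - \<gamma> *\<^sub>R x" for x
    by (simp add: B'_def blinfun.bilinear_simps)
  have Q': "Q' x \<bullet> y = Q x \<bullet> y - \<gamma>\<^sup>2 * (x \<bullet> y) + \<gamma> * (B x \<bullet> y + x \<bullet> B y)" for x y
    by (simp add: Q'_def blinfun.bilinear_simps inner_simps adj_inner')
  have acc: "(\<mu> - \<gamma>) * (norm x)\<^sup>2 \<le> B' x \<bullet> x" for x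
    using \<mu>(3)[of x] by (simp add: B' inner_simps power2_norm_eq_inner algebra_simps)
  have sa: "self_adjoint Q'"
    unfolding self_adjoint_def
  proof (intro allI)
    fix x y
    have "Q' x \<bullet> y = Q' y \<bullet> x"
      using Q(1) unfolding Q' self_adjoint_def by (simp add: inner_commute)
    then show "Q' x \<bullet> y = x \<bullet> Q' y"
      by (simp add: inner_commute)
  qed
  have nonneg: "0 \<le> Q' x \<bullet> x" for x
  proof -
    have "\<gamma> * (\<gamma> * (norm x)\<^sup>2) \<le> \<gamma> * (\<mu> * (norm x)\<^sup>2)"
      using \<mu>(1,2) by (intro mult_left_mono mult_right_mono) simp_all
    moreover have "\<gamma> * (\<mu> * (norm x)\<^sup>2) \<le> \<gamma> * (B x \<bullet> x)"
      by (intro mult_left_mono \<mu>)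
    ultimately show ?thesis
      using Q(2)[of x] unfolding Q' 
      by (simp add: inner_commute[of x "B x"] power2_norm_eq_inner[symmetric] power2_eq_square
          algebra_simps)
  qed
  obtain S where S: "self_adjoint S" "\<And>x. 0 \<le> S x \<bullet> x"
    "\<And>x y. S x \<bullet> B' y + B' x \<bullet> S y + S x \<bullet> S y = Q' x \<bullet> y"
    using riccati_nonneg_solvable[OF _ acc sa nonneg] \<mu>(2) by auto
  define P where "P = S - \<gamma> *\<^sub>R id_blinfun"
  have P: "P x = S x - \<gamma> *\<^sub>R x" for x
    by (simp add: P_def blinfun.bilinear_simps)
  show thesis
  proof (rule that)
    show "self_adjoint P"
      unfolding P_def by (intro self_adjoint_arith S)
    show "- \<gamma> * (norm x)\<^sup>2 \<le> P x \<bullet> x" for x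
      using S(2)[of x] by (simp add: P inner_simps power2_norm_eq_inner)
    show "P x \<bullet> B y + B x \<bullet> P y + P x \<bullet> P y = Q x \<bullet> y" for x y
      using S(3)[of x y] S(1) unfolding Q' self_adjoint_def
      by (simp add: P B' inner_simps power2_eq_square algebra_simps)
  qed
qed

text \<open>
  The difference \<open>D\<close> of two solutions \<open>P\<close> and \<open>R\<close> solves the homogeneous Lyapunov equation for the operator
  \<open>C = B + (P + R) / 2\<close>, which is at least \<open>\<mu> - \<gamma>\<close>.
\<close>

lemma riccati_bounded_unique:
  fixes B P Q R :: "'a::{real_inner,banach} \<Rightarrow>\<^sub>L 'a"
  assumes \<mu>: "\<gamma> < \<mu>" "\<And>x. \<mu> * (norm x)\<^sup>2 \<le> B x \<bullet> x"
    and P: "self_adjoint P" "\<And>x. - \<gamma> * (norm x)\<^sup>2 \<le> P x \<bullet> x"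
      "\<And>x. P x \<bullet> B x + B x \<bullet> P x + P x \<bullet> P x = Q x \<bullet> x"
    and R: "self_adjoint R" "\<And>x. - \<gamma> * (norm x)\<^sup>2 \<le> R x \<bullet> x"
      "\<And>x. R x \<bullet> B x + B x \<bullet> R x + R x \<bullet> R x = Q x \<bullet> x"
  shows "P = R"
proof -
  define C where "C = B + (1/2) *\<^sub>R (P + R)"
  have "P - R = 0"
  proof (rule lyapunov_unique)
    show "0 < \<mu> - \<gamma>"
      using \<mu> by simp
    show "(\<mu> - \<gamma>) * (norm x)\<^sup>2 \<le> C x \<bullet> x" for x
      using \<mu>(2)[of x] P(2)[of x] R(2)[of x]
      by (simp add: C_def blinfun.bilinear_simps inner_simps algebra_simps)
    show "self_adjoint (P - R)"
      using P R by (simp add: self_adjoint_arith)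
    show "(P - R) x \<bullet> C x = 0" for x
      using P(3)[of x] R(3)[of x]
      by (simp add: C_def blinfun.bilinear_simps inner_simps inner_commute field_simps)
  qed
  then show ?thesis
    by simp
qed


section \<open>Orthonormal systems\<close>

text \<open>
  Zero entries are admitted, so that a system indexed by \<^typ>\<open>nat\<close> can span a space of any
  finite dimension as well.
\<close>

definition orthonormal_system :: "(nat \<Rightarrow> 'a::real_inner) \<Rightarrow> bool" where
  "orthonormal_system e \<longleftrightarrow> (\<forall>i j. e i \<bullet> e j = (if i = j \<and> e i \<noteq> 0 then 1 else 0))"

text \<open>
  The Fourier sum over \<open>I\<close> is the best approximation in the span of the system, and the squared distance
  is what is missing in Bessel's inequality. It is stated for any index type because it is applied to
  sequences and to orthonormal bases indexed by themselves.
\<close>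

lemma residual_orthonormal:
  fixes e :: "'i \<Rightarrow> 'a::real_inner"
  assumes "finite I" and e: "\<And>i j. i \<in> I \<Longrightarrow> j \<in> I \<Longrightarrow> e i \<bullet> e j = (if i = j \<and> e i \<noteq> 0 then 1 else 0)"
  shows "(norm (x - (\<Sum>i\<in>I. (x \<bullet> e i) *\<^sub>R e i)))\<^sup>2 = (norm x)\<^sup>2 - (\<Sum>i\<in>I. (x \<bullet> e i)\<^sup>2)"
    and "(norm (x - (\<Sum>i\<in>I. (x \<bullet> e i) *\<^sub>R e i)))\<^sup>2 \<le> (norm (x - (\<Sum>i\<in>I. c i *\<^sub>R e i)))\<^sup>2"
proof -
  have cross: "(\<Sum>i\<in>I. a i *\<^sub>R e i) \<bullet> (\<Sum>i\<in>I. b i *\<^sub>R e i) = (\<Sum>i\<in>I. if e i = 0 then 0 else a i * b i)" for a b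
  proof -
    have "(\<Sum>i\<in>I. a i *\<^sub>R e i) \<bullet> (\<Sum>i\<in>I. b i *\<^sub>R e i) =
        (\<Sum>i\<in>I. \<Sum>j\<in>I. a i * b j * (if i = j \<and> e i \<noteq> 0 then 1 else 0))"
      unfolding inner_sum_left unfolding inner_sum_right
      by (intro sum.cong refl) (simp add: e)
    also have "\<dots> = (\<Sum>i\<in>I. \<Sum>j\<in>I. if i = j then (if e i = 0 then 0 else a i * b i) else 0)"
      by (intro sum.cong refl) auto
    also have "\<dots> = (\<Sum>i\<in>I. if e i = 0 then 0 else a i * b i)"
      using \<open>finite I\<close> by (simp add: sum.delta')
    finally show ?thesis .
  qed
  have gen: "(norm (x - (\<Sum>i\<in>I. a i *\<^sub>R e i)))\<^sup>2 =
      (norm x)\<^sup>2 - (\<Sum>i\<in>I. 2 * a i * (x \<bullet> e i) - (if e i = 0 then 0 else a i * a i))" for a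
  proof -
    have "(norm (x - (\<Sum>i\<in>I. a i *\<^sub>R e i)))\<^sup>2 = (norm x)\<^sup>2 - 2 * (x \<bullet> (\<Sum>i\<in>I. a i *\<^sub>R e i))
        + (\<Sum>i\<in>I. a i *\<^sub>R e i) \<bullet> (\<Sum>i\<in>I. a i *\<^sub>R e i)"
      by (simp add: power2_norm_eq_inner inner_diff_left inner_diff_right inner_commute)
    also have "\<dots> = (norm x)\<^sup>2 - (\<Sum>i\<in>I. 2 * a i * (x \<bullet> e i) - (if e i = 0 then 0 else a i * a i))"
      unfolding cross unfolding sum_subtractf inner_sum_right
      by (simp add: sum_distrib_left mult_ac)
    finally show ?thesis .
  qed
  show 1: "(norm (x - (\<Sum>i\<in>I. (x \<bullet> e i) *\<^sub>R e i)))\<^sup>2 = (norm x)\<^sup>2 - (\<Sum>i\<in>I. (x \<bullet> e i)\<^sup>2)"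
    unfolding gen by (intro arg_cong2[of _ _ _ _ minus] sum.cong refl) (simp add: power2_eq_square)
  have "2 * c i * (x \<bullet> e i) - (if e i = 0 then 0 else c i * c i) \<le> (x \<bullet> e i)\<^sup>2" for i
    using zero_le_power2[of "c i - x \<bullet> e i"] by (simp add: power2_eq_square algebra_simps)
  then show "(norm (x - (\<Sum>i\<in>I. (x \<bullet> e i) *\<^sub>R e i)))\<^sup>2 \<le> (norm (x - (\<Sum>i\<in>I. c i *\<^sub>R e i)))\<^sup>2"
    unfolding 1 unfolding gen by (intro diff_left_mono sum_mono)
qed

lemma bessel_inequality:
  assumes "orthonormal_system e" "finite I"
  shows "(\<Sum>i\<in>I. (x \<bullet> e i)\<^sup>2) \<le> (norm x)\<^sup>2"
  using residual_orthonormal(1)[where I = I and e = e and x = x] zero_le_power2[of "norm (x - (\<Sum>i\<in>I. (x \<bullet> e i) *\<^sub>R e i))"] assms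
  unfolding orthonormal_system_def by fastforce

text \<open>
  A finite combination of \<open>F \<subseteq> B\<close> close to \<open>x\<close> exists by density. For every finite \<open>G \<supseteq> F\<close> the Fourier sum
  over \<open>G\<close> is at least as close, so the partial sums converge along the finite subsets of \<open>B\<close>.
\<close>

lemma parseval:
  assumes B: "orthonormal_basis B"
  shows "((\<lambda>b. (x \<bullet> b)\<^sup>2) has_sum (norm x)\<^sup>2) B"
proof -
  have on: "b \<bullet> c = (if b = c \<and> b \<noteq> 0 then 1 else 0)" if "b \<in> B" "c \<in> B" for b c
    using B that by (auto simp: orthonormal_basis_def pairwise_def orthogonal_def norm_eq_1)
  have le: "(\<Sum>b\<in>F. (x \<bullet> b)\<^sup>2) \<le> (norm x)\<^sup>2" if "finite F" "F \<subseteq> B" for F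
    using residual_orthonormal(1)[where I = F and e = "\<lambda>b. b" and x = x] on that
      zero_le_power2[of "norm (x - (\<Sum>b\<in>F. (x \<bullet> b) *\<^sub>R b))"] by (auto simp: subset_iff)
  show ?thesis
    unfolding has_sum_def tendsto_iff eventually_finite_subsets_at_top
  proof (intro allI impI)
    fix \<epsilon> :: real assume "0 < \<epsilon>"
    have "x \<in> closure (span B)"
      using B by (simp add: orthonormal_basis_def)
    then obtain y where y: "y \<in> span B" "dist y x < sqrt \<epsilon>"
      using \<open>0 < \<epsilon>\<close> unfolding closure_approachable by (meson real_sqrt_gt_zero)
    then obtain F c where F: "finite F" "F \<subseteq> B" "y = (\<Sum>b\<in>F. c b *\<^sub>R b)"
      unfolding span_explicit by auto
    have "dist (\<Sum>b\<in>G. (x \<bullet> b)\<^sup>2) ((norm x)\<^sup>2) < \<epsilon>" if G: "finite G" "F \<subseteq> G" "G \<subseteq> B" for G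
    proof -
      define c' where "c' b = (if b \<in> F then c b else 0)" for b
      have y': "y = (\<Sum>b\<in>G. c' b *\<^sub>R b)"
        unfolding F(3) using G by (intro sum.mono_neutral_cong_left) (auto simp: c'_def)
      have onG: "\<And>b c. b \<in> G \<Longrightarrow> c \<in> G \<Longrightarrow> b \<bullet> c = (if b = c \<and> b \<noteq> 0 then 1 else 0)"
        using on G by blast
      have "(norm x)\<^sup>2 - (\<Sum>b\<in>G. (x \<bullet> b)\<^sup>2) \<le> (norm (x - y))\<^sup>2"
        using residual_orthonormal[where I = G and e = "\<lambda>b. b" and x = x] onG G unfolding y' by simp
      also have "\<dots> < (sqrt \<epsilon>)\<^sup>2"
        using y(2) by (intro power_strict_mono) (simp_all add: dist_norm norm_minus_commute)
      finally show ?thesis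
        using le[OF G(1,3)] \<open>0 < \<epsilon>\<close> by (simp add: dist_norm)
    qed
    with F show "\<exists>X. finite X \<and> X \<subseteq> B \<and> (\<forall>Y. finite Y \<and> X \<subseteq> Y \<and> Y \<subseteq> B \<longrightarrow>
        dist (\<Sum>b\<in>Y. (x \<bullet> b)\<^sup>2) ((norm x)\<^sup>2) < \<epsilon>)"
      by blast
  qed
qed

text \<open>
  The orthonormalisation is done in \<open>'a\<close>, but for the inner product pulled back along \<open>T\<close>. With the
  embedding \<open>\<iota>\<close> for \<open>T\<close> it produces vectors of \<open>V\<close> that are orthonormal in \<open>H\<close>. Redundant vectors
  \<open>d n\<close> give \<open>g e n = 0\<close>, and then \<open>e n = 0\<close> because \<open>inverse 0 = 0\<close>.
\<close>

lemma gram_schmidt: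
  fixes T :: "'a::real_inner \<Rightarrow>\<^sub>L 'b::real_inner" and d :: "nat \<Rightarrow> 'a"
  assumes "inj T"
  obtains e where "orthonormal_system (\<lambda>i. T (e i))" "range d \<subseteq> span (range e)"
proof -
  have T0: "T x = 0 \<longleftrightarrow> x = 0" for x
    using assms by (metis blinfun.zero_right injD)
  define g where "g E n = d n - (\<Sum>i<n. (T (d n) \<bullet> T (E i)) *\<^sub>R E i)" for E n
  have "\<exists>e. \<forall>n. e n = g e n /\<^sub>R norm (T (g e n))"
  proof -
    define F where "F E n = g E n /\<^sub>R norm (T (g E n))" for E n
    have "adm_wf less_than F"
      unfolding adm_wf_def
    proof (intro allI impI)
      fix f f' :: "nat \<Rightarrow> 'a" and n assume "\<forall>z. (z, n) \<in> less_than \<longrightarrow> f z = f' z"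
      then have "g f n = g f' n"
        unfolding g_def by (intro arg_cong2[of _ _ _ _ minus] sum.cong) auto
      then show "F f n = F f' n"
        by (simp add: F_def)
    qed
    then have "wfrec less_than F n = F (wfrec less_than F) n" for n
      by (rule wfrec_fixpoint[OF wf_less_than, THEN fun_cong])
    then show ?thesis
      unfolding F_def by blast
  qed
  then obtain e where e: "\<And>n. e n = g e n /\<^sub>R norm (T (g e n))"
    by blast
  have diag: "T (e n) \<bullet> T (e n) = (if T (e n) \<noteq> 0 then 1 else 0)" for n
  proof (cases "g e n = 0")
    case True
    then show ?thesis
      using e[of n] by (simp add: blinfun.bilinear_simps)
  next
    case False
    then have "T (g e n) \<noteq> 0"
      by (simp add: T0)
    moreover from this have "norm (T (e n)) = 1"
      by (subst e) (simp add: blinfun.bilinear_simps)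
    ultimately show ?thesis
      by (auto simp: norm_eq_1)
  qed
  have off: "T (e n) \<bullet> T (e j) = 0" if "j < n" for n j
    using that
  proof (induction n arbitrary: j rule: less_induct)
    case (less n)
    have orth: "T (e i) \<bullet> T (e j) = (if i = j then T (e j) \<bullet> T (e j) else 0)" if "i < n" for i
      using less that by (metis inner_commute linorder_neqE_nat)
    have "T (g e n) \<bullet> T (e j) = T (d n) \<bullet> T (e j) -
        (\<Sum>i<n. (T (d n) \<bullet> T (e i)) * (T (e i) \<bullet> T (e j)))"
      by (simp add: g_def blinfun.bilinear_simps inner_simps inner_sum_left blinfun.sum_right)
    also have "(\<Sum>i<n. (T (d n) \<bullet> T (e i)) * (T (e i) \<bullet> T (e j))) =
        (\<Sum>i<n. if i = j then (T (d n) \<bullet> T (e j)) * (T (e j) \<bullet> T (e j)) else 0)"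
    proof (intro sum.cong refl)
      fix i assume "i \<in> {..<n}"
      then show "(T (d n) \<bullet> T (e i)) * (T (e i) \<bullet> T (e j)) =
          (if i = j then (T (d n) \<bullet> T (e j)) * (T (e j) \<bullet> T (e j)) else 0)"
        using orth[of i] by (cases "i = j") auto
    qed
    also have "\<dots> = (T (d n) \<bullet> T (e j)) * (T (e j) \<bullet> T (e j))"
      using less.prems by simp
    also have "\<dots> = T (d n) \<bullet> T (e j)"
      by (subst diag) auto
    finally have "T (g e n) \<bullet> T (e j) = 0"
      by simp
    then show ?case
      by (subst e) (simp add: blinfun.bilinear_simps)
  qed
  have "orthonormal_system (\<lambda>i. T (e i))"
    unfolding orthonormal_system_def
    using diag off by (metis inner_commute linorder_neqE_nat)
  moreover have "d n \<in> span (range e)" for n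
  proof -
    have "g e n = norm (T (g e n)) *\<^sub>R e n"
    proof (cases "g e n = 0")
      case False
      then have "norm (T (g e n)) *\<^sub>R (g e n /\<^sub>R norm (T (g e n))) = g e n"
        by (simp add: T0)
      then show ?thesis
        by (metis e)
    qed simp
    then have "g e n \<in> span (range e)"
      by (metis rangeI span_base span_scale)
    moreover have "(\<Sum>i<n. (T (d n) \<bullet> T (e i)) *\<^sub>R e i) \<in> span (range e)"
      by (intro span_sum span_scale span_base) simp
    ultimately have "g e n + (\<Sum>i<n. (T (d n) \<bullet> T (e i)) *\<^sub>R e i) \<in> span (range e)"
      by (rule span_add)
    then show ?thesis
      by (simp add: g_def)
  qed
  ultimately show thesis
    using that by blast
qed

lemma orthonormal_basis_of_system:
  assumes "orthonormal_system f" "closure (span (range f)) = UNIV"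
  shows "orthonormal_basis (range f - {0})"
proof -
  have "norm (f i) = 1" if "f i \<noteq> 0" for i
    using assms(1) that unfolding orthonormal_system_def norm_eq_1 by presburger
  moreover have "pairwise orthogonal (range f - {0})"
    using assms(1) unfolding pairwise_def orthogonal_def orthonormal_system_def by auto
  moreover have "span (range f - {0}) = span (range f)"
    by (rule span_delete_0)
  ultimately show ?thesis
    using assms(2) by (auto simp: orthonormal_basis_def)
qed

lemma dense_sequence:
  obtains d :: "nat \<Rightarrow> 'a::{second_countable_topology,metric_space}" where "closure (range d) = UNIV"
proof -
  obtain D :: "'a set" where D: "countable D" "\<And>X. open X \<Longrightarrow> X \<noteq> {} \<Longrightarrow> \<exists>d\<in>D. d \<in> X"
    by (rule countable_dense_setE) blast
  have "D \<noteq> {}"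
    using D(2)[of UNIV] by auto
  have "x \<in> closure D" for x
    unfolding closure_approachable
  proof (intro allI impI)
    fix \<epsilon> :: real assume "0 < \<epsilon>"
    then have "\<exists>d\<in>D. d \<in> ball x \<epsilon>"
      by (intro D(2)) auto
    then show "\<exists>y\<in>D. dist y x < \<epsilon>"
      by (auto simp: dist_commute)
  qed
  then have "closure (range (from_nat_into D)) = UNIV"
    using range_from_nat_into[OF \<open>D \<noteq> {}\<close> D(1)] by auto
  then show thesis
    by (rule that)
qed


section \<open>Hilbert--Schmidt sums\<close>

text \<open>
  Both sides are sums of the numbers \<open>(T b \<bullet> f i)\<^sup>2\<close>: Parseval in \<open>b\<close> gives the left-hand side, and Bessel
  in \<open>i\<close> gives the inequality. It bounds the Hilbert--Schmidt sum of the adjoint in every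
  orthonormal system; for a self-adjoint \<open>T\<close> this is a change of basis.
\<close>

lemma hs_adjoint_sum_le:
  fixes T :: "'a::{real_inner,banach} \<Rightarrow>\<^sub>L 'b::{real_inner,banach}"
  assumes B: "orthonormal_basis B" and T: "(\<lambda>b. (norm (T b))\<^sup>2) summable_on B"
    and f: "orthonormal_system f" and "finite I"
  shows "(\<Sum>i\<in>I. (norm (adj T (f i)))\<^sup>2) \<le> (\<Sum>\<^sub>\<infinity>b\<in>B. (norm (T b))\<^sup>2)"
proof (rule has_sum_mono)
  have p: "((\<lambda>b. (adj T (f i) \<bullet> b)\<^sup>2) has_sum (norm (adj T (f i)))\<^sup>2) B" for i
    by (rule parseval[OF B])
  show "((\<lambda>b. \<Sum>i\<in>I. (adj T (f i) \<bullet> b)\<^sup>2) has_sum (\<Sum>i\<in>I. (norm (adj T (f i)))\<^sup>2)) B"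
    using \<open>finite I\<close> by (induction I rule: finite_induct) (simp_all add: has_sum_add p)
  show "((\<lambda>b. (norm (T b))\<^sup>2) has_sum (\<Sum>\<^sub>\<infinity>b\<in>B. (norm (T b))\<^sup>2)) B"
    using T by simp
  show "(\<Sum>i\<in>I. (adj T (f i) \<bullet> b)\<^sup>2) \<le> (norm (T b))\<^sup>2" for b
    using bessel_inequality[OF f \<open>finite I\<close>, of "T b"] by (simp add: inner_commute[of _ "T b"] flip: adj_inner')
qed

lemma hilbert_schmidtI:
  fixes T :: "'a::{real_inner,banach} \<Rightarrow>\<^sub>L 'b::{real_inner,banach}"
  assumes f: "orthonormal_system f" "closure (span (range f)) = UNIV"
    and le: "\<And>n. (\<Sum>i<n. (norm (T (f i)))\<^sup>2) \<le> C"
  shows "hilbert_schmidt T"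
proof -
  define J where "J = {i. f i \<noteq> 0}"
  have inj: "inj_on f J"
  proof (rule inj_onI)
    fix i j assume "i \<in> J" "j \<in> J" "f i = f j"
    then show "i = j"
      using f(1) unfolding J_def orthonormal_system_def by (metis mem_Collect_eq zero_neq_one)
  qed
  have "(\<lambda>i. (norm (T (f i)))\<^sup>2) summable_on J"
  proof (rule nonneg_bdd_above_summable_on)
    show "bdd_above (sum (\<lambda>i. (norm (T (f i)))\<^sup>2) ` {F. F \<subseteq> J \<and> finite F})"
    proof (rule bdd_aboveI2)
      fix F assume "F \<in> {F. F \<subseteq> J \<and> finite F}"
      then obtain n where n: "F \<subseteq> {..<n}"
        using finite_nat_bounded by blast
      then have "(\<Sum>i\<in>F. (norm (T (f i)))\<^sup>2) \<le> (\<Sum>i<n. (norm (T (f i)))\<^sup>2)"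
        by (intro sum_mono2) auto
      then show "(\<Sum>i\<in>F. (norm (T (f i)))\<^sup>2) \<le> C"
        using le[of n] by linarith
    qed
  qed simp
  then have "(\<lambda>b. (norm (T b))\<^sup>2) summable_on f ` J"
    using summable_on_reindex[OF inj, of "\<lambda>b. (norm (T b))\<^sup>2"] by (simp add: o_def)
  moreover have "f ` J = range f - {0}"
    by (auto simp: J_def)
  ultimately show ?thesis
    unfolding hilbert_schmidt_def using orthonormal_basis_of_system[OF f] by auto
qed


section \<open>Weak limits and compact embeddings\<close>

text \<open>
  Weak sequential compactness of balls: a diagonal subsequence converges when tested with a countable
  dense set, hence with every vector, and the limit functional is represented by a vector.
\<close>

lemma bounded_sequence_weak_limit:
  fixes x :: "nat \<Rightarrow> 'a::{real_inner,banach,second_countable_topology}"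
  assumes bound: "\<And>n. norm (x n) \<le> K"
  obtains r p where "strict_mono r" "\<And>y. (\<lambda>n. x (r n) \<bullet> y) \<longlonglongrightarrow> p \<bullet> y"
proof -
  obtain d :: "nat \<Rightarrow> 'a" where d: "closure (range d) = UNIV"
    by (rule dense_sequence)
  have "0 \<le> K"
    using bound[of 0] norm_ge_zero[of "x 0"] by linarith
  have le: "\<bar>x n \<bullet> y\<bar> \<le> K * norm y" for n y
    using Cauchy_Schwarz_ineq2[of "x n" y] mult_right_mono[OF bound[of n], of "norm y"] by simp
  interpret subseqs "\<lambda>k s. convergent (\<lambda>n. x (s n) \<bullet> d k)"
  proof
    fix k and s :: "nat \<Rightarrow> nat"
    have "bounded (range (\<lambda>n. x (s n) \<bullet> d k))"
      using le by (auto intro!: boundedI)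
    then obtain l r' where "strict_mono r'" "((\<lambda>n. x (s n) \<bullet> d k) \<circ> r') \<longlonglongrightarrow> l"
      using bounded_imp_convergent_subsequence by blast
    then show "\<exists>r'. strict_mono r' \<and> convergent (\<lambda>n. x ((s \<circ> r') n) \<bullet> d k)"
      by (auto simp: convergent_def o_def)
  qed
  define r where "r = diagseq"
  have r: "strict_mono r"
    unfolding r_def by (rule subseq_diagseq)
  have diag: "convergent (\<lambda>n. x ((diagseq \<circ> (+) (Suc k)) n) \<bullet> d k)" for k
  proof (rule diagseq_holds)
    fix r s :: "nat \<Rightarrow> nat" and k
    assume "strict_mono r" "convergent (\<lambda>n. x (s n) \<bullet> d k)"
    then show "convergent (\<lambda>n. x ((s \<circ> r) n) \<bullet> d k)"
      using convergent_subseq_convergent[of "\<lambda>n. x (s n) \<bullet> d k" r] by (simp add: o_def)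
  qed
  have conv_d: "Cauchy (\<lambda>n. x (r n) \<bullet> d k)" for k
  proof (rule convergent_Cauchy)
    have "convergent (\<lambda>n. x (r (n + Suc k)) \<bullet> d k)"
      using diag[of k] unfolding r_def comp_def by (simp only: add.commute[of "Suc k"])
    then show "convergent (\<lambda>n. x (r n) \<bullet> d k)"
      by (rule convergent_ignore_initial_segment[THEN iffD1])
  qed
  have "Cauchy (\<lambda>n. x (r n) \<bullet> y)" for y
  proof (rule metric_CauchyI)
    fix \<epsilon> :: real assume "0 < \<epsilon>"
    define \<delta> where "\<delta> = \<epsilon> / (3 * (K + 1))"
    have \<delta>: "0 < \<delta>" "K * \<delta> \<le> \<epsilon> / 3"
      using \<open>0 < \<epsilon>\<close> \<open>0 \<le> K\<close> by (simp_all add: \<delta>_def field_simps)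
    have "y \<in> closure (range d)"
      by (simp add: d)
    then obtain k where k: "dist (d k) y < \<delta>"
      using \<delta>(1) unfolding closure_approachable by blast
    obtain M where M: "\<And>m n. M \<le> m \<Longrightarrow> M \<le> n \<Longrightarrow> dist (x (r m) \<bullet> d k) (x (r n) \<bullet> d k) < \<epsilon> / 3"
      using metric_CauchyD[OF conv_d[of k], of "\<epsilon> / 3"] \<open>0 < \<epsilon>\<close> by auto
    have small: "\<bar>x m \<bullet> y - x m \<bullet> d k\<bar> \<le> \<epsilon> / 3" for m
    proof -
      have "\<bar>x m \<bullet> y - x m \<bullet> d k\<bar> \<le> K * norm (y - d k)"
        using le[of m "y - d k"] by (simp add: inner_simps)
      also have "\<dots> \<le> K * \<delta>"
        using k \<open>0 \<le> K\<close> by (intro mult_left_mono) (simp_all add: dist_norm norm_minus_commute)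
      finally show ?thesis
        using \<delta>(2) by linarith
    qed
    have "dist (x (r m) \<bullet> y) (x (r n) \<bullet> y) < \<epsilon>" if "M \<le> m" "M \<le> n" for m n
      using small[of "r m"] small[of "r n"] M[OF that] unfolding dist_real_def by linarith
    then show "\<exists>M. \<forall>m\<ge>M. \<forall>n\<ge>M. dist (x (r m) \<bullet> y) (x (r n) \<bullet> y) < \<epsilon>"
      by blast
  qed
  then have "\<exists>l. (\<lambda>n. x (r n) \<bullet> y) \<longlonglongrightarrow> l" for y
    using Cauchy_convergent convergent_def by blast
  then obtain f where f: "\<And>y. (\<lambda>n. x (r n) \<bullet> y) \<longlonglongrightarrow> f y"
    by metis
  have "bounded_linear f"
  proof (rule bounded_linear_intro)
    fix y z and c :: real
    show "f (y + z) = f y + f z"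
      using tendsto_add[OF f[of y] f[of z]] f[of "y + z"]
      by (auto simp: inner_add_right intro: LIMSEQ_unique)
    show "f (c *\<^sub>R y) = c *\<^sub>R f y"
      using tendsto_mult[OF tendsto_const f[of y], of c] f[of "c *\<^sub>R y"]
      by (auto intro: LIMSEQ_unique)
    show "norm (f y) \<le> norm y * K"
      by (rule tendsto_upperbound[OF tendsto_norm[OF f]])
        (use le in \<open>simp_all add: mult.commute\<close>)
  qed
  then have "blinfun_apply (Blinfun f) = f"
    by (rule bounded_linear_Blinfun_apply)
  then obtain p where "\<And>y. f y = p \<bullet> y"
    using riesz_representation[of "Blinfun f"] by auto
  then show thesis
    using f by (intro that[OF r]) simp
qed

text \<open>
  The mode of convergence in which the Galerkin solutions converge: weak in \<open>V\<close>, which suffices for the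
  terms of the Riccati equation that are linear in the solution, and strong in \<open>H\<close>, which its quadratic
  term requires.
\<close>

definition weak_strong_limit ::
    "('v::real_inner \<Rightarrow>\<^sub>L 'h::real_inner) \<Rightarrow> (nat \<Rightarrow> 'v) \<Rightarrow> 'v \<Rightarrow> bool" where
  "weak_strong_limit \<iota> x p \<longleftrightarrow>
     (\<forall>y. (\<lambda>n. x n \<bullet> y) \<longlonglongrightarrow> p \<bullet> y) \<and> (\<lambda>n. \<iota> (x n)) \<longlonglongrightarrow> \<iota> p"

lemma weak_strong_limit_subseq:
  assumes "weak_strong_limit \<iota> x p" "strict_mono r"
  shows "weak_strong_limit \<iota> (\<lambda>n. x (r n)) p"
  unfolding weak_strong_limit_def
proof (intro conjI allI)
  show "(\<lambda>n. x (r n) \<bullet> y) \<longlonglongrightarrow> p \<bullet> y" for y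
    using LIMSEQ_subseq_LIMSEQ[of "\<lambda>n. x n \<bullet> y", OF _ assms(2)] assms(1)
    by (simp add: weak_strong_limit_def o_def)
  show "(\<lambda>n. \<iota> (x (r n))) \<longlonglongrightarrow> \<iota> p"
    using LIMSEQ_subseq_LIMSEQ[of "\<lambda>n. \<iota> (x n)", OF _ assms(2)] assms(1)
    by (simp add: weak_strong_limit_def o_def)
qed

lemma compact_embedding_subseq:
  fixes \<iota> :: "'v::{real_inner,banach,second_countable_topology} \<Rightarrow>\<^sub>L 'h::real_inner"
    and x :: "nat \<Rightarrow> 'v"
  assumes cpt: "\<And>S. bounded S \<Longrightarrow> compact (closure (\<iota> ` S))" and bound: "\<And>n. norm (x n) \<le> K"
  obtains r p where "strict_mono r" "weak_strong_limit \<iota> (\<lambda>n. x (r n)) p"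
proof -
  obtain r p where r: "strict_mono r" "\<And>y. (\<lambda>n. x (r n) \<bullet> y) \<longlonglongrightarrow> p \<bullet> y"
    by (rule bounded_sequence_weak_limit[of x K, OF bound]) blast
  have "bounded (range x)"
    using bound by (auto intro: boundedI)
  then have "seq_compact (closure (\<iota> ` range x))"
    using cpt compact_imp_seq_compact by blast
  moreover have "\<forall>n. \<iota> (x (r n)) \<in> closure (\<iota> ` range x)"
    using closure_subset[of "\<iota> ` range x"] by auto
  ultimately obtain s q where s: "strict_mono s" "((\<lambda>n. \<iota> (x (r n))) \<circ> s) \<longlonglongrightarrow> q"
    by (rule seq_compactE)
  have weak: "(\<lambda>n. x (r (s n)) \<bullet> y) \<longlonglongrightarrow> p \<bullet> y" for y
    using LIMSEQ_subseq_LIMSEQ[OF r(2)[of y] s(1)] by (simp add: o_def)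
  have "q = \<iota> p"
  proof (rule inner_eqI)
    fix h
    have "(\<lambda>n. \<iota> (x (r (s n))) \<bullet> h) \<longlonglongrightarrow> q \<bullet> h"
      using s(2) by (intro tendsto_intros) (simp add: o_def)
    moreover have "(\<lambda>n. \<iota> (x (r (s n))) \<bullet> h) \<longlonglongrightarrow> \<iota> p \<bullet> h"
      unfolding adj_inner by (rule weak)
    ultimately show "q \<bullet> h = \<iota> p \<bullet> h"
      by (rule LIMSEQ_unique)
  qed
  with s(2) weak have "weak_strong_limit \<iota> (\<lambda>n. x ((r \<circ> s) n)) p"
    by (simp add: weak_strong_limit_def o_def)
  then show thesis
    by (rule that[OF strict_mono_o[OF r(1) s(1)]])
qed

lemma compact_embedding_diagonal_subseq:
  fixes \<iota> :: "'v::{real_inner,banach,second_countable_topology} \<Rightarrow>\<^sub>L 'h::real_inner"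
    and x :: "nat \<Rightarrow> nat \<Rightarrow> 'v"
  assumes cpt: "\<And>S. bounded S \<Longrightarrow> compact (closure (\<iota> ` S))" and bound: "\<And>n i. norm (x n i) \<le> K"
  obtains r p where "strict_mono r" "\<And>i. weak_strong_limit \<iota> (\<lambda>n. x (r n) i) (p i)"
proof -
  interpret subseqs "\<lambda>i s. \<exists>p. weak_strong_limit \<iota> (\<lambda>n. x (s n) i) p"
  proof
    fix i and s :: "nat \<Rightarrow> nat"
    obtain r' p where "strict_mono r'" "weak_strong_limit \<iota> (\<lambda>n. x (s (r' n)) i) p"
      by (rule compact_embedding_subseq[of \<iota> "\<lambda>n. x (s n) i" K, OF cpt bound])
    then show "\<exists>r'. strict_mono r' \<and> (\<exists>p. weak_strong_limit \<iota> (\<lambda>n. x ((s \<circ> r') n) i) p)"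
      by auto
  qed
  have diag: "\<exists>p. weak_strong_limit \<iota> (\<lambda>n. x ((diagseq \<circ> (+) (Suc i)) n) i) p" for i
  proof (rule diagseq_holds)
    fix r s :: "nat \<Rightarrow> nat" and i
    assume "strict_mono r" "\<exists>p. weak_strong_limit \<iota> (\<lambda>n. x (s n) i) p"
    then show "\<exists>p. weak_strong_limit \<iota> (\<lambda>n. x ((s \<circ> r) n) i) p"
      using weak_strong_limit_subseq[of \<iota> "\<lambda>n. x (s n) i" _ r] by auto
  qed
  \<comment> \<open>The name keeps the definition of \<open>weak_strong_limit\<close>, which occurs inside \<open>diagseq\<close>, from being
    unfolded there.\<close>
  define r where "r = diagseq"
  have "\<exists>p. weak_strong_limit \<iota> (\<lambda>n. x (r n) i) p" for i
  proof -
    obtain p where p: "weak_strong_limit \<iota> (\<lambda>n. x (r (n + Suc i)) i) p"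
      using diag[of i] unfolding comp_def r_def by (auto simp only: add.commute[of "Suc i"])
    have "weak_strong_limit \<iota> (\<lambda>n. x (r n) i) p"
      unfolding weak_strong_limit_def
    proof (intro conjI allI)
      show "(\<lambda>n. x (r n) i \<bullet> y) \<longlonglongrightarrow> p \<bullet> y" for y
        by (rule LIMSEQ_offset[where k = "Suc i"]) (use p in \<open>simp add: weak_strong_limit_def\<close>)
      show "(\<lambda>n. \<iota> (x (r n) i)) \<longlonglongrightarrow> \<iota> p"
        by (rule LIMSEQ_offset[where k = "Suc i"]) (use p in \<open>simp add: weak_strong_limit_def\<close>)
    qed
    then show ?thesis
      by blast
  qed
  then obtain p where "\<And>i. weak_strong_limit \<iota> (\<lambda>n. x (r n) i) (p i)"
    by metis
  then show thesis
    using that subseq_diagseq[folded r_def] by blast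
qed


section \<open>Galerkin approximation\<close>

definition rank_one :: "'a::real_inner \<Rightarrow> 'b::real_normed_vector \<Rightarrow> 'a \<Rightarrow>\<^sub>L 'b" where
  "rank_one a b = blinfun_scaleR_left b o\<^sub>L blinfun_inner_left a"

lemma rank_one_apply: "rank_one a b x = (x \<bullet> a) *\<^sub>R b"
  by (simp add: rank_one_def blinfun_inner_left.rep_eq)

text \<open>
  Let \<open>J\<close> send \<open>x\<close> to \<open>\<Sum>i<n. (x \<bullet> \<iota> (e i)) e i\<close>, so that \<open>\<iota> J\<close> is the orthogonal projection \<open>proj\<close> of \<open>H\<close> onto
  the span of the first \<open>n\<close> basis vectors. The bounded operator \<open>B = J* A J + \<mu>\<^sub>H (1 - proj)\<close> inherits the
  lower bound \<open>\<mu>\<^sub>H\<close>, so the Riccati equation with coefficients \<open>B\<close> and \<open>proj Q proj\<close> has a solution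
  \<open>P \<ge> -\<gamma>\<close>. The reflection \<open>2 proj - 1\<close> commutes with both coefficients; by uniqueness it commutes with \<open>P\<close>,
  which thus leaves the span invariant. The vectors \<open>p i\<close> are the images of the basis vectors under \<open>P\<close>,
  seen in \<open>V\<close>, and the first conclusion is the Riccati equation tested with basis vectors.

  The bound on the Hilbert--Schmidt norm comes from testing the equation with \<open>P\<close> itself:
  \<open>2 \<Sum>i A (p i) \<bullet> p i + \<Sum>i P (p i) \<bullet> p i = \<Sum>i Q (\<iota> (e i)) \<bullet> \<iota> (p i)\<close>, with \<open>p i\<close> read in \<open>H\<close> where needed. One of the
  two copies of \<open>A\<close> absorbs the negative part of \<open>P\<close> and, with the margin \<open>\<mu>\<^sub>H - \<gamma>\<close>, the right-hand side;
  the other copy controls the norm of \<open>V\<close>. The bound does not depend on \<open>n\<close>.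
\<close>

lemma galerkin_solution:
  fixes \<iota> :: "'v::{real_inner,banach} \<Rightarrow>\<^sub>L 'h::{real_inner,banach}" and A :: "'v \<Rightarrow>\<^sub>L 'v"
    and Q :: "'h \<Rightarrow>\<^sub>L 'h"
  assumes "inj \<iota>" and e: "orthonormal_system (\<lambda>i. \<iota> (e i))"
    and \<mu>V: "0 < \<mu>\<^sub>V" "\<And>u. \<mu>\<^sub>V * (norm u)\<^sup>2 \<le> A u \<bullet> u"
    and \<mu>H: "\<And>u. \<mu>\<^sub>H * (norm (\<iota> u))\<^sup>2 \<le> A u \<bullet> u"
    and \<gamma>: "0 \<le> \<gamma>" "\<gamma> < \<mu>\<^sub>H"
    and Q: "self_adjoint Q" "\<And>x. - \<gamma>\<^sup>2 * (norm x)\<^sup>2 \<le> Q x \<bullet> x"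
    and C: "(\<Sum>i<n. (norm (Q (\<iota> (e i))))\<^sup>2) \<le> C"
  obtains p where
    "\<And>i j. i < n \<Longrightarrow> j < n \<Longrightarrow>
      A (e j) \<bullet> p i + A (e i) \<bullet> p j + \<iota> (p i) \<bullet> \<iota> (p j) = Q (\<iota> (e i)) \<bullet> \<iota> (e j)"
    "\<And>i j. i < n \<Longrightarrow> j < n \<Longrightarrow> \<iota> (p i) \<bullet> \<iota> (e j) = \<iota> (e i) \<bullet> \<iota> (p j)"
    "\<And>N c. N \<le> n \<Longrightarrow> - \<gamma> * (norm (\<Sum>i<N. c i *\<^sub>R \<iota> (e i)))\<^sup>2
      \<le> (\<Sum>i<N. \<Sum>j<N. c i * c j * (\<iota> (p i) \<bullet> \<iota> (e j)))"
    "(\<Sum>i<n. (norm (p i))\<^sup>2) \<le> C / (4 * \<mu>\<^sub>V * (\<mu>\<^sub>H - \<gamma>))"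
    "\<And>i. e i = 0 \<Longrightarrow> p i = 0"
proof -
  have \<iota>0: "\<iota> x = 0 \<longleftrightarrow> x = 0" for x
    using \<open>inj \<iota>\<close> by (metis blinfun.zero_right injD)
  define J where "J = (\<Sum>i<n. rank_one (\<iota> (e i)) (e i))"
  have J: "J x = (\<Sum>i<n. (x \<bullet> \<iota> (e i)) *\<^sub>R e i)" for x
    by (simp add: J_def blinfun.sum_left rank_one_apply)
  define proj where "proj = \<iota> o\<^sub>L J"
  have proj_J: "proj x = \<iota> (J x)" for x
    by (simp add: proj_def)
  have proj: "proj x = (\<Sum>i<n. (x \<bullet> \<iota> (e i)) *\<^sub>R \<iota> (e i))" for x
    by (simp add: proj_J J blinfun.bilinear_simps blinfun.sum_right)
  have J_e: "J (\<iota> (e i)) = e i" if "i < n" for i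
  proof -
    have "(\<iota> (e i) \<bullet> \<iota> (e j)) *\<^sub>R e j = (if j = i then e i else 0)" for j
      using e unfolding orthonormal_system_def by (auto simp: \<iota>0)
    then show ?thesis
      using that by (simp add: J)
  qed
  have proj_sa: "proj x \<bullet> y = x \<bullet> proj y" for x y
    by (simp add: proj inner_sum_left inner_sum_right inner_commute mult.commute)
  have J_proj: "J (proj x) = J x" for x
  proof -
    have "J (proj x) = (\<Sum>i<n. (x \<bullet> \<iota> (e i)) *\<^sub>R J (\<iota> (e i)))"
      by (simp add: proj blinfun.bilinear_simps blinfun.sum_right)
    also have "\<dots> = J x"
      unfolding J[of x] by (intro sum.cong refl) (simp add: J_e)
    finally show ?thesis .
  qed
  have proj_proj: "proj (proj x) = proj x" for x
    by (simp add: proj_J[of "proj x"] J_proj) (simp add: proj_J)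
  have proj_inner: "proj x \<bullet> x = (norm (proj x))\<^sup>2" for x
    by (metis proj_proj proj_sa power2_norm_eq_inner)
  have pyth: "(norm x)\<^sup>2 = (norm (proj x))\<^sup>2 + (norm (x - proj x))\<^sup>2" for x
  proof -
    have "(norm (x - proj x))\<^sup>2 = (norm x)\<^sup>2 - 2 * (proj x \<bullet> x) + (norm (proj x))\<^sup>2"
      by (simp add: power2_norm_eq_inner inner_simps inner_commute)
    then show ?thesis
      by (simp add: proj_inner)
  qed
  define B where "B = (adj J o\<^sub>L A o\<^sub>L J) + \<mu>\<^sub>H *\<^sub>R (id_blinfun - proj)"
  have B: "B x \<bullet> y = A (J x) \<bullet> J y + \<mu>\<^sub>H * ((x - proj x) \<bullet> y)" for x y
    by (simp add: B_def blinfun.bilinear_simps inner_simps flip: adj_inner')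
  define Q' where "Q' = proj o\<^sub>L Q o\<^sub>L proj"
  have Q': "Q' x \<bullet> y = Q (proj x) \<bullet> proj y" for x y
    by (simp add: Q'_def proj_sa)
  have B_acc: "\<mu>\<^sub>H * (norm x)\<^sup>2 \<le> B x \<bullet> x" for x
  proof -
    have "(x - proj x) \<bullet> x = (norm (x - proj x))\<^sup>2"
      using pyth[of x] by (simp add: inner_simps proj_inner power2_norm_eq_inner[of x])
    then show ?thesis
      using \<mu>H[of "J x"] unfolding B by (subst pyth) (simp add: proj_J algebra_simps)
  qed
  have Q'_sa: "self_adjoint Q'"
    using Q(1) unfolding self_adjoint_def Q' by (metis Q' inner_commute)
  have Q'_ge: "- \<gamma>\<^sup>2 * (norm x)\<^sup>2 \<le> Q' x \<bullet> x" for x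
  proof -
    have "\<gamma>\<^sup>2 * (norm (proj x))\<^sup>2 \<le> \<gamma>\<^sup>2 * (norm x)\<^sup>2"
      using pyth[of x] by (intro mult_left_mono) auto
    then show ?thesis
      using Q(2)[of "proj x"] unfolding Q' by simp
  qed
  obtain P where P: "self_adjoint P" "\<And>x. - \<gamma> * (norm x)\<^sup>2 \<le> P x \<bullet> x"
    "\<And>x y. P x \<bullet> B y + B x \<bullet> P y + P x \<bullet> P y = Q' x \<bullet> y"
    using riccati_bounded_solvable[OF \<gamma> B_acc Q'_sa Q'_ge] by blast
  define R where "R = 2 *\<^sub>R proj - id_blinfun"
  have R: "R x = 2 *\<^sub>R proj x - x" for x
    by (simp add: R_def blinfun.bilinear_simps)
  have RR: "R (R x) = x" for x
    by (simp add: R blinfun.bilinear_simps proj_proj scaleR_2)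
  have proj_R: "proj (R x) = proj x" for x
    by (simp add: R blinfun.bilinear_simps proj_proj scaleR_2)
  have R_sa: "R x \<bullet> y = x \<bullet> R y" for x y
    by (simp add: R inner_simps proj_sa)
  have R_iso: "R x \<bullet> R y = x \<bullet> y" for x y
    by (simp add: R_sa RR)
  have norm_R: "norm (R x) = norm x" for x
    by (simp add: norm_eq_sqrt_inner R_iso)
  have "B (proj x) = proj (B x)" for x
  proof (rule inner_eqI)
    fix y
    have "(x - proj x) \<bullet> proj y = 0"
      by (simp add: inner_simps proj_sa proj_proj)
    then show "B (proj x) \<bullet> y = proj (B x) \<bullet> y"
      by (simp add: proj_sa B J_proj proj_proj)
  qed
  then have RB: "R (B x) = B (R x)" for x
    by (simp add: R blinfun.bilinear_simps)
  have "R o\<^sub>L P o\<^sub>L R = P"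
  proof (rule riccati_bounded_unique[OF \<gamma>(2) B_acc, where Q = Q'])
    show "self_adjoint (R o\<^sub>L P o\<^sub>L R)"
      using P(1) by (simp add: self_adjoint_def R_sa)
    show "- \<gamma> * (norm x)\<^sup>2 \<le> (R o\<^sub>L P o\<^sub>L R) x \<bullet> x" for x
      using P(2)[of "R x"] by (simp add: R_sa norm_R)
    fix x
    have "(R o\<^sub>L P o\<^sub>L R) x \<bullet> B x + B x \<bullet> (R o\<^sub>L P o\<^sub>L R) x + (R o\<^sub>L P o\<^sub>L R) x \<bullet> (R o\<^sub>L P o\<^sub>L R) x
        = P (R x) \<bullet> B (R x) + B (R x) \<bullet> P (R x) + P (R x) \<bullet> P (R x)"
      by (simp add: R_iso RB[symmetric]) (simp add: R_sa RR)
    also have "\<dots> = Q' (R x) \<bullet> R x"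
      by (rule P(3))
    also have "\<dots> = Q' x \<bullet> x"
      by (simp add: Q' proj_R)
    finally show "(R o\<^sub>L P o\<^sub>L R) x \<bullet> B x + B x \<bullet> (R o\<^sub>L P o\<^sub>L R) x
        + (R o\<^sub>L P o\<^sub>L R) x \<bullet> (R o\<^sub>L P o\<^sub>L R) x = Q' x \<bullet> x" .
  qed (use P in auto)
  then have "R (P (R (R x))) = P (R x)" for x
    by (metis blinfun_apply_blinfun_compose)
  then have "R (P x) = P (R x)" for x
    by (simp add: RR)
  then have proj_P: "proj (P x) = P (proj x)" for x
    by (simp add: R blinfun.bilinear_simps)
  define p where "p i = J (P (\<iota> (e i)))" for i
  have proj_e: "proj (\<iota> (e i)) = \<iota> (e i)" if "i < n" for i
    using J_e[OF that] by (simp add: proj_J)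
  have \<iota>p: "\<iota> (p i) = P (\<iota> (e i))" if "i < n" for i
    using proj_P[of "\<iota> (e i)"] by (simp add: p_def proj_e[OF that] flip: proj_J)
  \<comment> \<open>The matrix of \<open>P\<close>. The Hilbert--Schmidt inner product with \<open>P\<close> is the sum over \<open>i\<close> and \<open>j\<close> weighted
    with \<open>m i j\<close>.\<close>
  define m where "m i j = \<iota> (p i) \<bullet> \<iota> (e j)" for i j
  have p_sum: "p i = (\<Sum>j<n. m i j *\<^sub>R e j)" if "i < n" for i
    unfolding m_def \<iota>p[OF that] by (simp only: p_def J)
  have eq: "A (e j) \<bullet> p i + A (e i) \<bullet> p j + \<iota> (p i) \<bullet> \<iota> (p j) = Q (\<iota> (e i)) \<bullet> \<iota> (e j)"
    if "i < n" "j < n" for i j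
    using P(3)[of "\<iota> (e i)" "\<iota> (e j)"] that
    by (simp add: inner_commute[of "P (\<iota> (e i))" "B (\<iota> (e j))"] B Q' J_e proj_e \<iota>p flip: p_def)
  have sym: "\<iota> (p i) \<bullet> \<iota> (e j) = \<iota> (e i) \<bullet> \<iota> (p j)" if "i < n" "j < n" for i j
    using P(1) that by (simp add: \<iota>p self_adjoint_def)
  have m_sym: "m i j = m j i" if "i < n" "j < n" for i j
    using sym[OF that] by (simp add: m_def inner_commute)
  have pos: "- \<gamma> * (norm (\<Sum>i<N. c i *\<^sub>R \<iota> (e i)))\<^sup>2
      \<le> (\<Sum>i<N. \<Sum>j<N. c i * c j * (\<iota> (p i) \<bullet> \<iota> (e j)))" if "N \<le> n" for N c
  proof -
    have "P (\<Sum>i<N. c i *\<^sub>R \<iota> (e i)) = (\<Sum>i<N. c i *\<^sub>R \<iota> (p i))"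
      by (simp add: blinfun.sum_right blinfun.bilinear_simps \<iota>p that order_less_le_trans[OF _ that])
    moreover have "(\<Sum>i<N. c i *\<^sub>R \<iota> (p i)) \<bullet> (\<Sum>j<N. c j *\<^sub>R \<iota> (e j))
        = (\<Sum>i<N. \<Sum>j<N. c i * c j * (\<iota> (p i) \<bullet> \<iota> (e j)))"
      unfolding inner_sum_left unfolding inner_sum_right
      by (intro sum.cong refl) simp
    ultimately show ?thesis
      using P(2)[of "\<Sum>i<N. c i *\<^sub>R \<iota> (e i)"] by simp
  qed
  \<comment> \<open>The margin that absorbs the right-hand side.\<close>
  define \<delta> where "\<delta> = \<mu>\<^sub>H - \<gamma>"
  have \<delta>: "0 < \<delta>"
    using \<gamma> by (simp add: \<delta>_def)
  have "(\<Sum>i<n. A (p i) \<bullet> p i) \<le> C / (4 * \<delta>)"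
  proof -
    have s1: "(\<Sum>j<n. m i j * (A (e j) \<bullet> p i)) = A (p i) \<bullet> p i" if "i < n" for i
    proof -
      have "A (p i) = (\<Sum>j<n. m i j *\<^sub>R A (e j))"
        by (subst p_sum[OF that]) (simp add: blinfun.sum_right blinfun.bilinear_simps)
      then show ?thesis
        by (simp add: inner_sum_left)
    qed
    have s2: "(\<Sum>i<n. \<Sum>j<n. m i j * (A (e i) \<bullet> p j)) = (\<Sum>i<n. A (p i) \<bullet> p i)"
    proof (subst sum.swap, intro sum.cong refl)
      fix j assume "j \<in> {..<n}"
      then have "(\<Sum>i<n. m i j * (A (e i) \<bullet> p j)) = (\<Sum>i<n. m j i * (A (e i) \<bullet> p j))"
        by (intro sum.cong refl) (simp add: m_sym)
      then show "(\<Sum>i<n. m i j * (A (e i) \<bullet> p j)) = A (p j) \<bullet> p j"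
        using s1 \<open>j \<in> {..<n}\<close> by simp
    qed
    have \<iota>p_sum: "\<iota> (p i) = (\<Sum>j<n. m i j *\<^sub>R \<iota> (e j))" if "i < n" for i
      by (subst p_sum[OF that]) (simp add: blinfun.sum_right blinfun.bilinear_simps)
    have s3: "(\<Sum>j<n. m i j * (\<iota> (p i) \<bullet> \<iota> (p j))) = \<iota> (p i) \<bullet> P (\<iota> (p i))" if "i < n" for i
    proof -
      have "P (\<iota> (p i)) = (\<Sum>j<n. m i j *\<^sub>R \<iota> (p j))"
        by (subst \<iota>p_sum[OF that]) (simp add: blinfun.sum_right blinfun.bilinear_simps \<iota>p)
      then show ?thesis
        by (simp add: inner_sum_right)
    qed
    have s4: "(\<Sum>j<n. m i j * (Q (\<iota> (e i)) \<bullet> \<iota> (e j))) = Q (\<iota> (e i)) \<bullet> \<iota> (p i)" if "i < n" for i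
      by (subst \<iota>p_sum[OF that]) (simp add: inner_sum_right)
    have "(\<Sum>i<n. \<Sum>j<n. m i j * (A (e j) \<bullet> p i)) + (\<Sum>i<n. \<Sum>j<n. m i j * (A (e i) \<bullet> p j))
        + (\<Sum>i<n. \<Sum>j<n. m i j * (\<iota> (p i) \<bullet> \<iota> (p j)))
        = (\<Sum>i<n. \<Sum>j<n. m i j * (Q (\<iota> (e i)) \<bullet> \<iota> (e j)))"
      unfolding sum.distrib[symmetric] distrib_left[symmetric]
      by (intro sum.cong refl) (simp add: eq)
    then have "(\<Sum>i<n. A (p i) \<bullet> p i) + (\<Sum>i<n. A (p i) \<bullet> p i) + (\<Sum>i<n. \<iota> (p i) \<bullet> P (\<iota> (p i)))
        = (\<Sum>i<n. Q (\<iota> (e i)) \<bullet> \<iota> (p i))"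
      unfolding s2 by (simp add: s1 s3 s4)
    then have "(\<Sum>i<n. A (p i) \<bullet> p i) =
        (\<Sum>i<n. Q (\<iota> (e i)) \<bullet> \<iota> (p i) - \<iota> (p i) \<bullet> P (\<iota> (p i)) - A (p i) \<bullet> p i)"
      by (simp add: sum_subtractf)
    also have "\<dots> \<le> (\<Sum>i<n. (norm (Q (\<iota> (e i))))\<^sup>2 / (4 * \<delta>))"
    proof (rule sum_mono)
      fix i
      let ?q = "norm (Q (\<iota> (e i)))" and ?u = "norm (\<iota> (p i))"
      have "0 \<le> (?q - 2 * \<delta> * ?u)\<^sup>2 / (4 * \<delta>)"
        using \<delta> by simp
      also have "\<dots> = ?q\<^sup>2 / (4 * \<delta>) + \<delta> * ?u\<^sup>2 - ?q * ?u"
        using \<delta> by (simp add: power2_eq_square field_simps)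
      finally have "?q * ?u \<le> ?q\<^sup>2 / (4 * \<delta>) + \<delta> * ?u\<^sup>2"
        by simp
      moreover have "\<delta> * ?u\<^sup>2 = \<mu>\<^sub>H * ?u\<^sup>2 - \<gamma> * ?u\<^sup>2"
        by (simp add: \<delta>_def algebra_simps)
      ultimately show "Q (\<iota> (e i)) \<bullet> \<iota> (p i) - \<iota> (p i) \<bullet> P (\<iota> (p i)) - A (p i) \<bullet> p i \<le> ?q\<^sup>2 / (4 * \<delta>)"
        using norm_cauchy_schwarz[of "Q (\<iota> (e i))" "\<iota> (p i)"] P(2)[of "\<iota> (p i)"] \<mu>H[of "p i"]
        by (simp add: inner_commute[of "P (\<iota> (p i))"])
    qed
    also have "\<dots> \<le> C / (4 * \<delta>)"
      using C \<delta> by (simp add: divide_right_mono flip: sum_divide_distrib)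
    finally show ?thesis .
  qed
  moreover have "\<mu>\<^sub>V * (\<Sum>i<n. (norm (p i))\<^sup>2) \<le> (\<Sum>i<n. A (p i) \<bullet> p i)"
    unfolding sum_distrib_left by (intro sum_mono \<mu>V)
  ultimately have "\<mu>\<^sub>V * (\<Sum>i<n. (norm (p i))\<^sup>2) \<le> C / (4 * \<delta>)"
    by linarith
  then have bound: "(\<Sum>i<n. (norm (p i))\<^sup>2) \<le> C / (4 * \<mu>\<^sub>V * (\<mu>\<^sub>H - \<gamma>))"
    using \<mu>V(1) \<delta> unfolding \<delta>_def[symmetric] by (simp add: field_simps)
  have "p i = 0" if "e i = 0" for i
    using that by (simp add: p_def blinfun.bilinear_simps)
  then show thesis
    using that[of p] eq sym pos bound by blast
qed


section \<open>Passage to the limit\<close>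

text \<open>
  The operator is \<open>\<Sum>i. p i \<otimes> f i\<close>. The partial sums are Cauchy in the operator norm: by Bessel and
  Cauchy--Schwarz, a block of the series has norm at most the square root of the block of
  \<open>\<Sum>i. (norm (p i))\<^sup>2\<close>.
\<close>

lemma square_summable_operator:
  fixes p :: "nat \<Rightarrow> 'b::{real_inner,banach}" and f :: "nat \<Rightarrow> 'a::{real_inner,banach}"
  assumes f: "orthonormal_system f" and K: "\<And>n. (\<Sum>i<n. (norm (p i))\<^sup>2) \<le> K"
  obtains T :: "'a \<Rightarrow>\<^sub>L 'b" where "\<And>i. f i \<noteq> 0 \<Longrightarrow> T (f i) = p i"
proof -
  define S where "S n = (\<Sum>i<n. rank_one (f i) (p i))" for n
  have S: "S n x = (\<Sum>i<n. (x \<bullet> f i) *\<^sub>R p i)" for n x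
    by (simp add: S_def blinfun.sum_left rank_one_apply)
  have "summable (\<lambda>i. (norm (p i))\<^sup>2)"
    by (rule bounded_imp_summable[of _ K]) (use K in \<open>simp_all del: sum.lessThan_Suc flip: lessThan_Suc_atMost\<close>)
  then have tail: "\<exists>N. \<forall>m\<ge>N. \<forall>n. norm (\<Sum>i=m..<n. (norm (p i))\<^sup>2) < \<epsilon>" if "0 < \<epsilon>" for \<epsilon>
    using that by (simp add: summable_Cauchy)
  have diff: "norm (S n - S m) \<le> sqrt (\<Sum>i=m..<n. (norm (p i))\<^sup>2)" if "m \<le> n" for m n
  proof (rule norm_blinfun_bound)
    fix x
    have "{..<n} = {..<m} \<union> {m..<n}"
      using that by auto
    then have "(\<Sum>i<n. (x \<bullet> f i) *\<^sub>R p i) = (\<Sum>i<m. (x \<bullet> f i) *\<^sub>R p i) + (\<Sum>i=m..<n. (x \<bullet> f i) *\<^sub>R p i)"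
      by (simp add: sum.union_disjoint ivl_disj_int)
    then have "(S n - S m) x = (\<Sum>i=m..<n. (x \<bullet> f i) *\<^sub>R p i)"
      by (simp add: blinfun.diff_left S)
    also have "norm \<dots> \<le> (\<Sum>i=m..<n. \<bar>x \<bullet> f i\<bar> * \<bar>norm (p i)\<bar>)"
      by (rule order_trans[OF norm_sum]) simp
    also have "\<dots> \<le> L2_set (\<lambda>i. x \<bullet> f i) {m..<n} * L2_set (\<lambda>i. norm (p i)) {m..<n}"
      by (rule L2_set_mult_ineq)
    also have "\<dots> \<le> norm x * L2_set (\<lambda>i. norm (p i)) {m..<n}"
    proof (rule mult_right_mono)
      have "(\<Sum>i=m..<n. (x \<bullet> f i)\<^sup>2) \<le> (norm x)\<^sup>2"
        by (rule bessel_inequality[OF f]) simp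
      then show "L2_set (\<lambda>i. x \<bullet> f i) {m..<n} \<le> norm x"
        unfolding L2_set_def by (intro real_le_lsqrt) (simp_all add: sum_nonneg)
    qed (simp add: L2_set_nonneg)
    finally show "norm ((S n - S m) x) \<le> sqrt (\<Sum>i=m..<n. (norm (p i))\<^sup>2) * norm x"
      by (simp add: L2_set_def mult.commute)
  qed (simp add: sum_nonneg)
  have "Cauchy S"
  proof (rule metric_CauchyI)
    fix \<epsilon> :: real assume "0 < \<epsilon>"
    then obtain N where N: "\<And>m n. N \<le> m \<Longrightarrow> norm (\<Sum>i=m..<n. (norm (p i))\<^sup>2) < \<epsilon>\<^sup>2"
      using tail[of "\<epsilon>\<^sup>2"] by auto
    have *: "dist (S m) (S n) < \<epsilon>" if "N \<le> m" "m \<le> n" for m n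
    proof -
      have "(\<Sum>i=m..<n. (norm (p i))\<^sup>2) < \<epsilon>\<^sup>2"
        using N[OF that(1), of n] by simp
      then have "sqrt (\<Sum>i=m..<n. (norm (p i))\<^sup>2) < \<epsilon>"
        using \<open>0 < \<epsilon>\<close> by (intro real_less_lsqrt) (simp_all add: sum_nonneg)
      then show ?thesis
        using diff[OF that(2)] by (simp add: dist_norm norm_minus_commute)
    qed
    have "dist (S m) (S n) < \<epsilon>" if "N \<le> m" "N \<le> n" for m n
      using *[of m n] *[of n m] that by (metis dist_commute nat_le_linear)
    then show "\<exists>N. \<forall>m\<ge>N. \<forall>n\<ge>N. dist (S m) (S n) < \<epsilon>"
      by blast
  qed
  then obtain T where T: "S \<longlonglongrightarrow> T"
    using Cauchy_convergent convergent_def by blast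
  have "T (f i) = p i" if "f i \<noteq> 0" for i
  proof (rule LIMSEQ_unique)
    show "(\<lambda>n. S n (f i)) \<longlonglongrightarrow> T (f i)"
      by (intro tendsto_intros T)
    have "S n (f i) = p i" if "i < n" for n
    proof -
      have "(f i \<bullet> f j) *\<^sub>R p j = (if j = i then p i else 0)" for j
        using f \<open>f i \<noteq> 0\<close> unfolding orthonormal_system_def by auto
      then show ?thesis
        using that by (simp add: S)
    qed
    then have "eventually (\<lambda>n. S n (f i) = p i) sequentially"
      by (rule eventually_mono[OF eventually_gt_at_top[of i]])
    then show "(\<lambda>n. S n (f i)) \<longlonglongrightarrow> p i"
      by (rule tendsto_eventually)
  qed
  then show thesis
    by (rule that)
qed

lemma eq_on_dense_span:
  fixes F G :: "'a::real_normed_vector \<Rightarrow>\<^sub>L 'b::real_normed_vector"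
  assumes "closure (span (range e)) = UNIV" "\<And>i. F (e i) = G (e i)"
  shows "F x = G x"
proof -
  have "F x = G x" if "x \<in> span (range e)" for x
    by (rule linear_eq_on_span[of F G, OF _ _ _ that])
      (use assms(2) in \<open>auto intro: bounded_linear.linear blinfun.bounded_linear_right\<close>)
  then have "F = G"
    using blinfun_eq_on_dense[OF assms(1)] by blast
  then show ?thesis
    by simp
qed

lemma span_range_sum:
  fixes f :: "nat \<Rightarrow> 'a::real_vector"
  assumes "x \<in> span (range f)"
  obtains N c where "x = (\<Sum>i<N. c i *\<^sub>R f i)"
proof -
  have "\<exists>N c. x = (\<Sum>i<N. c i *\<^sub>R f i)"
    using assms
  proof (induction rule: span_induct_alt)
    case base
    show ?case
      by (rule exI[of _ 0]) simp
  next
    case (step a y z)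
    then obtain i N c where y: "y = f i" and z: "z = (\<Sum>j<N. c j *\<^sub>R f j)"
      by auto
    define M where "M = max N (Suc i)"
    have "z = (\<Sum>j<M. (if j < N then c j else 0) *\<^sub>R f j)"
      unfolding z by (rule sum.mono_neutral_cong_left) (auto simp: M_def)
    moreover have "a *\<^sub>R y = (\<Sum>j<M. (if j = i then a else 0) *\<^sub>R f j)"
    proof -
      have "(\<Sum>j<M. (if j = i then a else 0) *\<^sub>R f j) = (\<Sum>j<M. if j = i then a *\<^sub>R f i else 0)"
        by (intro sum.cong) auto
      moreover have "i < M"
        by (simp add: M_def)
      ultimately show ?thesis
        by (simp add: y)
    qed
    ultimately have "a *\<^sub>R y + z =
        (\<Sum>j<M. ((if j = i then a else 0) + (if j < N then c j else 0)) *\<^sub>R f j)"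
      by (simp add: scaleR_add_left sum.distrib)
    then show ?case
      by (intro exI[of _ M] exI[of _ "\<lambda>j. (if j = i then a else 0) + (if j < N then c j else 0)"])
  qed
  then show thesis
    using that by blast
qed

lemma dense_span_image:
  fixes \<iota> :: "'a::real_normed_vector \<Rightarrow>\<^sub>L 'b::real_normed_vector"
  assumes "closure (range \<iota>) = UNIV" "closure (span (range e)) = UNIV"
  shows "closure (span (range (\<lambda>i. \<iota> (e i)))) = UNIV"
proof -
  have "\<iota> ` closure (span (range e)) \<subseteq> closure (\<iota> ` span (range e))"
    by (rule closure_bounded_linear_image_subset[OF blinfun.bounded_linear_right])
  also have "\<iota> ` span (range e) = span (\<iota> ` range e)"
    by (rule span_linear_image[symmetric])
      (intro bounded_linear.linear blinfun.bounded_linear_right)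
  finally have "range \<iota> \<subseteq> closure (span (range (\<lambda>i. \<iota> (e i))))"
    using assms(2) by (simp add: image_image)
  then have "closure (range \<iota>) \<subseteq> closure (span (range (\<lambda>i. \<iota> (e i))))"
    by (rule closure_minimal) simp
  then show ?thesis
    using assms(1) by auto
qed

text \<open>
  This is the theorem with the identifications undone: \<open>A\<close> takes values in \<open>V\<close> instead of its dual, and the
  unknown is the operator \<open>T\<close> from \<open>H\<close> to \<open>V\<close>. By the uniform bound and the compact embedding, a subsequence of
  the Galerkin solutions converges on every basis vector. The equation, symmetry and the lower bound
  pass to the limit on finite combinations of basis vectors, and the Hilbert--Schmidt bound by weak
  lower semicontinuity. The bound makes the limit an operator \<open>T\<close>, and density extends the relations to all vectors.
\<close>

lemma riccati_operator:
  fixes \<iota> :: "'v::{real_inner,banach,second_countable_topology} \<Rightarrow>\<^sub>L 'h::{real_inner,banach}"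
    and A :: "'v \<Rightarrow>\<^sub>L 'v" and Q :: "'h \<Rightarrow>\<^sub>L 'h"
  assumes emb: "compact_dense_embedding \<iota>"
    and \<mu>V: "0 < \<mu>\<^sub>V" "\<And>u. \<mu>\<^sub>V * (norm u)\<^sup>2 \<le> A u \<bullet> u"
    and \<mu>H: "\<And>u. \<mu>\<^sub>H * (norm (\<iota> u))\<^sup>2 \<le> A u \<bullet> u"
    and \<gamma>: "0 \<le> \<gamma>" "\<gamma> < \<mu>\<^sub>H"
    and Q: "hilbert_schmidt Q" "self_adjoint Q" "\<And>x. - \<gamma>\<^sup>2 * (norm x)\<^sup>2 \<le> Q x \<bullet> x"
  obtains T :: "'h \<Rightarrow>\<^sub>L 'v" where "hilbert_schmidt T" "hilbert_schmidt (\<iota> o\<^sub>L T)"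
    "self_adjoint (\<iota> o\<^sub>L T)" "\<And>x. - \<gamma> * (norm x)\<^sup>2 \<le> \<iota> (T x) \<bullet> x"
    "\<And>v w. A w \<bullet> T (\<iota> v) + A v \<bullet> T (\<iota> w) + \<iota> (T (\<iota> v)) \<bullet> \<iota> (T (\<iota> w)) = Q (\<iota> v) \<bullet> \<iota> w"
proof -
  have inj: "inj \<iota>" and dense: "closure (range \<iota>) = UNIV"
    and cpt: "\<And>S. bounded S \<Longrightarrow> compact (closure (\<iota> ` S))"
    using emb by (auto simp: compact_dense_embedding_def)
  obtain d :: "nat \<Rightarrow> 'v" where d: "closure (range d) = UNIV"
    by (rule dense_sequence)
  obtain e where e: "orthonormal_system (\<lambda>i. \<iota> (e i))" and de: "range d \<subseteq> span (range e)"
    by (rule gram_schmidt[OF inj, of d])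
  have e_dense: "closure (span (range e)) = UNIV"
    using closure_mono[OF de] d by auto
  have \<iota>e_dense: "closure (span (range (\<lambda>i. \<iota> (e i)))) = UNIV"
    by (rule dense_span_image[OF dense e_dense])
  have \<iota>0: "\<iota> x = 0 \<longleftrightarrow> x = 0" for x
    using inj by (metis blinfun.zero_right injD)
  obtain B where B: "orthonormal_basis B" "(\<lambda>b. (norm (Q b))\<^sup>2) summable_on B"
    using Q(1) unfolding hilbert_schmidt_def by blast
  define C where "C = (\<Sum>\<^sub>\<infinity>b\<in>B. (norm (Q b))\<^sup>2)"
  have adj_Q: "adj Q = Q"
  proof (rule blinfun_eqI, rule inner_eqI)
    show "adj Q x \<bullet> y = Q x \<bullet> y" for x y
      using Q(2) by (simp add: self_adjoint_def flip: adj_inner')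
  qed
  have C: "(\<Sum>i<n. (norm (Q (\<iota> (e i))))\<^sup>2) \<le> C" for n
    using hs_adjoint_sum_le[OF B e, of "{..<n}"] by (simp add: adj_Q C_def)
  define K where "K = C / (4 * \<mu>\<^sub>V * (\<mu>\<^sub>H - \<gamma>))"
  define sol where "sol n p \<longleftrightarrow>
    (\<forall>i<n. \<forall>j<n. A (e j) \<bullet> p i + A (e i) \<bullet> p j + \<iota> (p i) \<bullet> \<iota> (p j) = Q (\<iota> (e i)) \<bullet> \<iota> (e j)) \<and>
    (\<forall>i<n. \<forall>j<n. \<iota> (p i) \<bullet> \<iota> (e j) = \<iota> (e i) \<bullet> \<iota> (p j)) \<and>
    (\<forall>N\<le>n. \<forall>c. - \<gamma> * (norm (\<Sum>i<N. c i *\<^sub>R \<iota> (e i)))\<^sup>2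
      \<le> (\<Sum>i<N. \<Sum>j<N. c i * c j * (\<iota> (p i) \<bullet> \<iota> (e j)))) \<and>
    (\<Sum>i<n. (norm (p i))\<^sup>2) \<le> K \<and>
    (\<forall>i. e i = 0 \<longrightarrow> p i = 0)" for n p
  have "\<exists>p. sol n p" for n
    by (rule galerkin_solution[OF inj e \<mu>V \<mu>H \<gamma> Q(2,3) C[of n]], rule exI,
        unfold sol_def K_def, intro conjI allI impI)
  then obtain q where q: "\<And>n. sol n (q n)"
    by metis
  \<comment> \<open>Values at indices beyond the Galerkin space are set to zero, so that the bound is uniform in both
    indices.\<close>
  define x where "x n i = (if i < n then q n i else 0)" for n i
  have x_K: "(\<Sum>i<N. (norm (x n i))\<^sup>2) \<le> K" for N n
  proof -
    have "(\<Sum>i<N. (norm (x n i))\<^sup>2) \<le> (\<Sum>i<max N n. (norm (x n i))\<^sup>2)"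
      by (rule sum_mono2) auto
    also have "\<dots> = (\<Sum>i<n. (norm (q n i))\<^sup>2)"
      by (rule sum.mono_neutral_cong_right) (auto simp: x_def)
    also have "\<dots> \<le> K"
      using q[of n] by (simp add: sol_def)
    finally show ?thesis .
  qed
  have "norm (x n i) \<le> sqrt K" for n i
  proof (rule real_le_rsqrt)
    have "(norm (x n i))\<^sup>2 \<le> (\<Sum>j<Suc i. (norm (x n j))\<^sup>2)"
      by (rule member_le_sum) auto
    then show "(norm (x n i))\<^sup>2 \<le> K"
      using x_K[of n "Suc i"] by linarith
  qed
  then obtain r p where r: "strict_mono r" and lim: "\<And>i. weak_strong_limit \<iota> (\<lambda>n. x (r n) i) (p i)"
    using compact_embedding_diagonal_subseq[OF cpt, of x "sqrt K"] by blast
  have weak: "(\<lambda>n. x (r n) i \<bullet> y) \<longlonglongrightarrow> p i \<bullet> y" for i y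
    using lim[of i] by (simp add: weak_strong_limit_def)
  have weak': "(\<lambda>n. y \<bullet> x (r n) i) \<longlonglongrightarrow> y \<bullet> p i" for i y
    using weak[of i y] by (simp add: inner_commute)
  have strong: "(\<lambda>n. \<iota> (x (r n) i)) \<longlonglongrightarrow> \<iota> (p i)" for i
    using lim[of i] by (simp add: weak_strong_limit_def)
  have large: "eventually (\<lambda>n. N < r n) sequentially" for N
    by (rule eventually_compose_filterlim[OF eventually_gt_at_top filterlim_subseq[OF r]])
  have eq: "A (e j) \<bullet> p i + A (e i) \<bullet> p j + \<iota> (p i) \<bullet> \<iota> (p j) = Q (\<iota> (e i)) \<bullet> \<iota> (e j)" for i j
  proof (rule LIMSEQ_unique)
    show "(\<lambda>n. A (e j) \<bullet> x (r n) i + A (e i) \<bullet> x (r n) j + \<iota> (x (r n) i) \<bullet> \<iota> (x (r n) j))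
        \<longlonglongrightarrow> A (e j) \<bullet> p i + A (e i) \<bullet> p j + \<iota> (p i) \<bullet> \<iota> (p j)"
      by (intro tendsto_add tendsto_inner weak' strong)
    have "eventually (\<lambda>n. A (e j) \<bullet> x (r n) i + A (e i) \<bullet> x (r n) j + \<iota> (x (r n) i) \<bullet> \<iota> (x (r n) j)
        = Q (\<iota> (e i)) \<bullet> \<iota> (e j)) sequentially"
      using large[of "max i j"]
    proof eventually_elim
      case (elim n)
      then show ?case
        using q[of "r n"] by (simp add: sol_def x_def)
    qed
    then show "(\<lambda>n. A (e j) \<bullet> x (r n) i + A (e i) \<bullet> x (r n) j + \<iota> (x (r n) i) \<bullet> \<iota> (x (r n) j))
        \<longlonglongrightarrow> Q (\<iota> (e i)) \<bullet> \<iota> (e j)"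
      by (rule tendsto_eventually)
  qed
  have sym: "\<iota> (p i) \<bullet> \<iota> (e j) = \<iota> (e i) \<bullet> \<iota> (p j)" for i j
  proof (rule LIMSEQ_unique)
    show "(\<lambda>n. \<iota> (x (r n) i) \<bullet> \<iota> (e j)) \<longlonglongrightarrow> \<iota> (p i) \<bullet> \<iota> (e j)"
      by (intro tendsto_intros strong)
    have "eventually (\<lambda>n. \<iota> (e i) \<bullet> \<iota> (x (r n) j) = \<iota> (x (r n) i) \<bullet> \<iota> (e j)) sequentially"
      using large[of "max i j"]
    proof eventually_elim
      case (elim n)
      then show ?case
        using q[of "r n"] by (simp add: sol_def x_def)
    qed
    moreover have "(\<lambda>n. \<iota> (e i) \<bullet> \<iota> (x (r n) j)) \<longlonglongrightarrow> \<iota> (e i) \<bullet> \<iota> (p j)"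
      by (intro tendsto_intros strong)
    ultimately show "(\<lambda>n. \<iota> (x (r n) i) \<bullet> \<iota> (e j)) \<longlonglongrightarrow> \<iota> (e i) \<bullet> \<iota> (p j)"
      by (rule Lim_transform_eventually[rotated])
  qed
  have pos: "- \<gamma> * (norm (\<Sum>i<N. c i *\<^sub>R \<iota> (e i)))\<^sup>2
      \<le> (\<Sum>i<N. \<Sum>j<N. c i * c j * (\<iota> (p i) \<bullet> \<iota> (e j)))" for N c
  proof (rule tendsto_lowerbound)
    show "(\<lambda>n. \<Sum>i<N. \<Sum>j<N. c i * c j * (\<iota> (x (r n) i) \<bullet> \<iota> (e j)))
        \<longlonglongrightarrow> (\<Sum>i<N. \<Sum>j<N. c i * c j * (\<iota> (p i) \<bullet> \<iota> (e j)))"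
      by (intro tendsto_intros strong)
    show "eventually (\<lambda>n. - \<gamma> * (norm (\<Sum>i<N. c i *\<^sub>R \<iota> (e i)))\<^sup>2
        \<le> (\<Sum>i<N. \<Sum>j<N. c i * c j * (\<iota> (x (r n) i) \<bullet> \<iota> (e j)))) sequentially"
      using large[of N]
    proof eventually_elim
      case (elim n)
      then have "(\<Sum>i<N. \<Sum>j<N. c i * c j * (\<iota> (x (r n) i) \<bullet> \<iota> (e j)))
          = (\<Sum>i<N. \<Sum>j<N. c i * c j * (\<iota> (q (r n) i) \<bullet> \<iota> (e j)))"
        by (intro sum.cong refl) (simp add: x_def)
      moreover have "- \<gamma> * (norm (\<Sum>i<N. c i *\<^sub>R \<iota> (e i)))\<^sup>2
          \<le> (\<Sum>i<N. \<Sum>j<N. c i * c j * (\<iota> (q (r n) i) \<bullet> \<iota> (e j)))"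
        using q[of "r n"] less_imp_le[OF elim] unfolding sol_def by blast
      ultimately show ?case
        by (simp only:)
    qed
  qed simp
  have p_K: "(\<Sum>i<N. (norm (p i))\<^sup>2) \<le> K" for N
  proof (rule tendsto_upperbound)
    \<comment> \<open>Expanding \<open>0 \<le> (norm (x - p))\<^sup>2\<close> bounds \<open>(norm x)\<^sup>2\<close> from below by an affine function of \<open>x\<close>,
      which is weakly continuous and attains \<open>(norm p)\<^sup>2\<close> at \<open>p\<close>.\<close>
    have "(\<lambda>n. \<Sum>i<N. 2 * (x (r n) i \<bullet> p i) - (norm (p i))\<^sup>2)
        \<longlonglongrightarrow> (\<Sum>i<N. 2 * (p i \<bullet> p i) - (norm (p i))\<^sup>2)"
      by (intro tendsto_intros weak)
    then show "(\<lambda>n. \<Sum>i<N. 2 * (x (r n) i \<bullet> p i) - (norm (p i))\<^sup>2) \<longlonglongrightarrow> (\<Sum>i<N. (norm (p i))\<^sup>2)"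
      by (simp add: power2_norm_eq_inner)
    have "2 * (x (r n) i \<bullet> p i) - (norm (p i))\<^sup>2 \<le> (norm (x (r n) i))\<^sup>2" for n i
      using inner_ge_zero[of "x (r n) i - p i"]
      by (simp add: power2_norm_eq_inner inner_simps inner_commute)
    then have "(\<Sum>i<N. 2 * (x (r n) i \<bullet> p i) - (norm (p i))\<^sup>2) \<le> K" for n
      using x_K[of "r n" N] by (meson order_trans sum_mono)
    then show "eventually (\<lambda>n. (\<Sum>i<N. 2 * (x (r n) i \<bullet> p i) - (norm (p i))\<^sup>2) \<le> K) sequentially"
      by simp
  qed simp
  have p_0: "p i = 0" if "e i = 0" for i
  proof -
    have "x n i = 0" for n
      using q[of n] that by (simp add: sol_def x_def)
    then have "p i \<bullet> y = 0" for y
      using LIMSEQ_unique[OF weak[of i y], of 0] by simp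
    then show ?thesis
      by (metis inner_eq_zero_iff)
  qed
  obtain T :: "'h \<Rightarrow>\<^sub>L 'v" where T0: "\<And>i. \<iota> (e i) \<noteq> 0 \<Longrightarrow> T (\<iota> (e i)) = p i"
    using square_summable_operator[OF e, of p K] p_K by blast
  have T: "T (\<iota> (e i)) = p i" for i
    using T0[of i] p_0[of i] by (cases "e i = 0") (simp_all add: \<iota>0)
  show thesis
  proof (rule that)
    show "hilbert_schmidt T"
      by (rule hilbert_schmidtI[OF e \<iota>e_dense, of _ K]) (simp add: T p_K)
    show "hilbert_schmidt (\<iota> o\<^sub>L T)"
    proof (rule hilbert_schmidtI[OF e \<iota>e_dense])
      fix n
      have "(norm (\<iota> (p i)))\<^sup>2 \<le> (norm \<iota>)\<^sup>2 * (norm (p i))\<^sup>2" for i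
        using power_mono[OF norm_blinfun[of \<iota> "p i"], of 2] by (simp add: power_mult_distrib)
      then have "(\<Sum>i<n. (norm (\<iota> (p i)))\<^sup>2) \<le> (norm \<iota>)\<^sup>2 * (\<Sum>i<n. (norm (p i))\<^sup>2)"
        unfolding sum_distrib_left by (intro sum_mono)
      also have "\<dots> \<le> (norm \<iota>)\<^sup>2 * K"
        by (intro mult_left_mono p_K) simp
      finally show "(\<Sum>i<n. (norm ((\<iota> o\<^sub>L T) (\<iota> (e i))))\<^sup>2) \<le> (norm \<iota>)\<^sup>2 * K"
        by (simp add: T)
    qed
    have sa: "\<iota> (T y) \<bullet> z = y \<bullet> \<iota> (T z)" for y z
    proof -
      have 1: "\<iota> (T (\<iota> (e i))) \<bullet> z = \<iota> (e i) \<bullet> \<iota> (T z)" for i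
        using eq_on_dense_span[OF \<iota>e_dense, where F = "blinfun_inner_right (\<iota> (p i))"
            and G = "blinfun_inner_right (\<iota> (e i)) o\<^sub>L (\<iota> o\<^sub>L T)" and x = z]
        by (simp add: T sym)
      show ?thesis
        using eq_on_dense_span[OF \<iota>e_dense, where F = "blinfun_inner_left z o\<^sub>L (\<iota> o\<^sub>L T)"
            and G = "blinfun_inner_left (\<iota> (T z))" and x = y]
        by (simp add: 1)
    qed
    then show "self_adjoint (\<iota> o\<^sub>L T)"
      by (simp add: self_adjoint_def)
    show "- \<gamma> * (norm y)\<^sup>2 \<le> \<iota> (T y) \<bullet> y" for y
    proof -
      have "- \<gamma> * (norm y)\<^sup>2 \<le> \<iota> (T y) \<bullet> y" if y: "y \<in> span (range (\<lambda>i. \<iota> (e i)))" for y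
      proof -
        obtain N c where y: "y = (\<Sum>i<N. c i *\<^sub>R \<iota> (e i))"
          by (rule span_range_sum[OF y])
        have "\<iota> (T y) = (\<Sum>i<N. c i *\<^sub>R \<iota> (p i))"
          by (simp add: y blinfun.sum_right blinfun.bilinear_simps T)
        then have "\<iota> (T y) \<bullet> y = (\<Sum>i<N. c i *\<^sub>R \<iota> (p i)) \<bullet> (\<Sum>i<N. c i *\<^sub>R \<iota> (e i))"
          by (simp add: y)
        also have "\<dots> = (\<Sum>i<N. \<Sum>j<N. c i * c j * (\<iota> (p i) \<bullet> \<iota> (e j)))"
          unfolding inner_sum_left unfolding inner_sum_right by (intro sum.cong refl) simp
        finally show ?thesis
          using pos[where N = N and c = c] by (simp add: y)
      qed
      moreover have "closed {y. - \<gamma> * (norm y)\<^sup>2 \<le> \<iota> (T y) \<bullet> y}"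
        by (intro closed_Collect_le continuous_intros)
      ultimately have "closure (span (range (\<lambda>i. \<iota> (e i)))) \<subseteq> {y. - \<gamma> * (norm y)\<^sup>2 \<le> \<iota> (T y) \<bullet> y}"
        by (intro closure_minimal) auto
      then show ?thesis
        using \<iota>e_dense by auto
    qed
    show "A w \<bullet> T (\<iota> v) + A v \<bullet> T (\<iota> w) + \<iota> (T (\<iota> v)) \<bullet> \<iota> (T (\<iota> w)) = Q (\<iota> v) \<bullet> \<iota> w" for v w
    proof -
      \<comment> \<open>Both sides are bounded bilinear forms in \<open>v\<close> and \<open>w\<close>; written with operators \<open>F\<close> and \<open>G\<close> on \<open>V\<close>,
        they agree as soon as they agree on the dense span of the \<open>e i\<close>.\<close>
      define S where "S = T o\<^sub>L \<iota>"
      define F where "F = (adj S o\<^sub>L A) + (adj A o\<^sub>L S) + (adj S o\<^sub>L adj \<iota> o\<^sub>L \<iota> o\<^sub>L S)"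
      have F: "F v \<bullet> w = A w \<bullet> T (\<iota> v) + A v \<bullet> T (\<iota> w) + \<iota> (T (\<iota> v)) \<bullet> \<iota> (T (\<iota> w))" for v w
        by (simp add: F_def S_def blinfun.bilinear_simps inner_simps inner_commute[of "A w"]
            flip: adj_inner')
      define G where "G = adj \<iota> o\<^sub>L Q o\<^sub>L \<iota>"
      have G: "G v \<bullet> w = Q (\<iota> v) \<bullet> \<iota> w" for v w
        by (simp add: G_def flip: adj_inner')
      have "F (e i) = G (e i)" for i
      proof (rule inner_eqI)
        fix w
        show "F (e i) \<bullet> w = G (e i) \<bullet> w"
          using eq_on_dense_span[OF e_dense, where F = "blinfun_inner_right (F (e i))"
              and G = "blinfun_inner_right (G (e i))" and x = w]
          by (simp add: F G T eq)
      qed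
      then have "F v = G v"
        by (rule eq_on_dense_span[OF e_dense])
      then show ?thesis
        by (simp flip: F G)
    qed
  qed
qed


section \<open>Operators of the Gelfand triple\<close>

definition riesz_op :: "'a::{real_inner,banach} dual \<Rightarrow>\<^sub>L 'a" where
  "riesz_op = Blinfun riesz"

lemma riesz_op_apply: "riesz_op f = riesz f"
proof -
  have "bounded_linear (riesz :: 'a dual \<Rightarrow> 'a)"
    by (rule bounded_linear_intro[where K = 1]) (simp_all add: riesz_add riesz_scaleR norm_riesz)
  then show ?thesis
    by (simp add: riesz_op_def bounded_linear_Blinfun_apply)
qed

text \<open>
  The operator is the dual of \<open>T\<close> from \<open>V*\<close> to \<open>H\<close>. An orthonormal basis of \<open>V\<close> is carried to one of \<open>V*\<close> by
  the inverse \<open>D\<close> of the Riesz map, which is its adjoint because the Riesz map is unitary.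
\<close>

lemma hilbert_schmidt_dual_adjoint:
  fixes T :: "'h::{real_inner,banach} \<Rightarrow>\<^sub>L 'v::{real_inner,banach,second_countable_topology}"
  assumes "hilbert_schmidt T"
  shows "hilbert_schmidt (adj T o\<^sub>L riesz_op)"
proof -
  obtain d :: "nat \<Rightarrow> 'v" where d: "closure (range d) = UNIV"
    by (rule dense_sequence)
  have id_inj: "inj (id_blinfun :: 'v \<Rightarrow>\<^sub>L 'v)"
    by (simp add: inj_def)
  obtain v :: "nat \<Rightarrow> 'v" where v: "orthonormal_system v" "range d \<subseteq> span (range v)"
    by (rule gram_schmidt[OF id_inj, of d]) simp
  have v_dense: "closure (span (range v)) = UNIV"
    using closure_mono[OF v(2)] d by auto
  define D :: "'v \<Rightarrow>\<^sub>L 'v dual" where "D = adj riesz_op"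
  have riesz_D: "riesz (D x) = x" for x
  proof (rule riesz_eqI)
    fix y :: 'v
    define g where "g = Dual (blinfun_inner_right y)"
    have "riesz g = y"
      by (rule riesz_eqI) (simp add: g_def pairing_Dual)
    then have "pairing (D x) y = D x \<bullet> g"
      by (simp add: pairing_riesz inner_dual_def)
    also have "\<dots> = x \<bullet> y"
      by (simp add: D_def riesz_op_apply \<open>riesz g = y\<close> flip: adj_inner')
    finally show "pairing (D x) y = x \<bullet> y" .
  qed
  have D_riesz: "D (riesz f) = f" for f
    by (rule dual_eqI) (simp add: pairing_riesz riesz_D)
  have "closure (range D) = UNIV"
    using D_riesz by (metis closure_UNIV surjI)
  then have D_dense: "closure (span (range (\<lambda>i. D (v i)))) = UNIV"
    by (rule dense_span_image[OF _ v_dense])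
  have "orthonormal_system (\<lambda>i. D (v i))"
    using v(1) riesz_D unfolding orthonormal_system_def
    by (metis blinfun.zero_right inner_dual_def riesz_D)
  moreover obtain B where B: "orthonormal_basis B" "(\<lambda>b. (norm (T b))\<^sup>2) summable_on B"
    using assms unfolding hilbert_schmidt_def by blast
  have "(\<Sum>i<n. (norm ((adj T o\<^sub>L riesz_op) (D (v i))))\<^sup>2) \<le> (\<Sum>\<^sub>\<infinity>b\<in>B. (norm (T b))\<^sup>2)" for n
    using hs_adjoint_sum_le[OF B v(1), of "{..<n}"] by (simp add: riesz_op_apply riesz_D)
  ultimately show ?thesis
    using D_dense by (intro hilbert_schmidtI)
qed

theorem theorem3p8:
  fixes \<iota> :: "'v::{real_inner,banach,second_countable_topology} \<Rightarrow>\<^sub>L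
              'h::{real_inner,banach,second_countable_topology}"
    and A :: "'v \<Rightarrow>\<^sub>L 'v dual"
    and \<mu>\<^sub>V \<mu>\<^sub>H \<gamma> :: real
    and Q :: "'v \<Rightarrow>\<^sub>L 'v dual"
  assumes "compact_dense_embedding \<iota>"
    and "\<mu>\<^sub>V > 0" and "\<And>u. pairing (A u) u \<ge> \<mu>\<^sub>V * (norm u)\<^sup>2"
    and "\<mu>\<^sub>H > 0" and "\<And>u. pairing (A u) u \<ge> \<mu>\<^sub>H * (norm (\<iota> u))\<^sup>2"
    and "0 \<le> \<gamma>" and "\<gamma> < \<mu>\<^sub>H"
    and "Q \<in> HS_cone \<iota> (- \<gamma>\<^sup>2)"
  shows "\<exists>P \<in> HS_V \<iota> \<inter> HS_cone \<iota> (- \<gamma>).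
           of_H_V' \<iota> (dual_op A o\<^sub>L as_H_V \<iota> P) + of_V_H \<iota> (as_V'_H \<iota> P o\<^sub>L A)
             + of_H_H \<iota> (as_H_H \<iota> P o\<^sub>L as_H_H \<iota> P) = Q"
proof -
  obtain R where R: "Q = of_H_H \<iota> R" "hilbert_schmidt R" "self_adjoint R" "op_ge R (- \<gamma>\<^sup>2)"
    using assms(8) unfolding HS_cone_def by blast
  define a where "a = riesz_op o\<^sub>L A"
  have a: "a u \<bullet> v = pairing (A u) v" for u v
    by (simp add: a_def riesz_op_apply pairing_riesz)
  have op_ge: "op_ge S \<beta> \<longleftrightarrow> (\<forall>x. \<beta> * (norm x)\<^sup>2 \<le> S x \<bullet> x)" for S :: "'h \<Rightarrow>\<^sub>L 'h" and \<beta>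
    by (simp add: op_ge_def blinfun.bilinear_simps inner_simps power2_norm_eq_inner)
  have R_ge: "- \<gamma>\<^sup>2 * (norm x)\<^sup>2 \<le> R x \<bullet> x" for x
    using R(4) by (simp add: op_ge)
  have a_V: "\<mu>\<^sub>V * (norm u)\<^sup>2 \<le> a u \<bullet> u" and a_H: "\<mu>\<^sub>H * (norm (\<iota> u))\<^sup>2 \<le> a u \<bullet> u" for u
    using assms(3,5) by (simp_all add: a)
  obtain T where T: "hilbert_schmidt T" "hilbert_schmidt (\<iota> o\<^sub>L T)"
    "self_adjoint (\<iota> o\<^sub>L T)" "\<And>x. - \<gamma> * (norm x)\<^sup>2 \<le> \<iota> (T x) \<bullet> x"
    "\<And>v w. a w \<bullet> T (\<iota> v) + a v \<bullet> T (\<iota> w) + \<iota> (T (\<iota> v)) \<bullet> \<iota> (T (\<iota> w)) = R (\<iota> v) \<bullet> \<iota> w"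
    by (rule riccati_operator[OF assms(1,2) a_V a_H assms(6,7) R(2,3) R_ge]) blast
  \<comment> \<open>The solution, seen as an operator from \<open>V*\<close> to \<open>H\<close>, is the dual of the solution from \<open>H\<close> to \<open>V\<close>.\<close>
  define T' where "T' = adj T o\<^sub>L riesz_op"
  have T': "T' f \<bullet> h = pairing f (T h)" for f h
    by (simp add: T'_def riesz_op_apply pairing_riesz flip: adj_inner')
  define P where "P = of_H_V \<iota> T"
  have sa: "\<iota> (T x) \<bullet> y = x \<bullet> \<iota> (T y)" for x y
    using T(3) by (simp add: self_adjoint_def)
  have P_HH: "of_H_H \<iota> (\<iota> o\<^sub>L T) = P"
    by (rule blinfun_eqI) (simp add: P_def of_H_H_def of_H_V_def)
  have "T' (to_dual \<iota> h) = \<iota> (T h)" for h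
    by (rule inner_eqI) (simp add: T' pairing_to_dual sa)
  then have P_V'H: "of_V'_H \<iota> T' = P"
    by (intro blinfun_eqI) (simp add: P_def of_V'_H_def of_H_V_def)
  have as_HH: "as_H_H \<iota> P = \<iota> o\<^sub>L T"
    unfolding as_H_H_def using P_HH inj_of_H_H[OF assms(1)] by (intro the_equality) (auto dest: injD)
  have as_HV: "as_H_V \<iota> P = T"
    unfolding as_H_V_def using P_def inj_of_H_V[OF assms(1)] by (intro the_equality) (auto dest: injD)
  have as_V'H: "as_V'_H \<iota> P = T'"
    unfolding as_V'_H_def using P_V'H inj_of_V'_H[OF assms(1)] by (intro the_equality) (auto dest: injD)
  show ?thesis
  proof (rule bexI[of _ P])
    have "hilbert_schmidt T'"
      unfolding T'_def by (rule hilbert_schmidt_dual_adjoint[OF T(1)])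
    then have "P \<in> HS_V \<iota>"
      unfolding HS_V_def using T(1) P_V'H P_def by blast
    moreover have "P \<in> HS_cone \<iota> (- \<gamma>)"
      unfolding HS_cone_def using T(2-4) P_HH by (auto simp: op_ge intro!: image_eqI[of _ _ "\<iota> o\<^sub>L T"])
    ultimately show "P \<in> HS_V \<iota> \<inter> HS_cone \<iota> (- \<gamma>)"
      by blast
    show "of_H_V' \<iota> (dual_op A o\<^sub>L as_H_V \<iota> P) + of_V_H \<iota> (as_V'_H \<iota> P o\<^sub>L A)
        + of_H_H \<iota> (as_H_H \<iota> P o\<^sub>L as_H_H \<iota> P) = Q"
    proof (rule blinfun_eqI, rule dual_eqI)
      fix v w
      have "pairing ((of_H_V' \<iota> (dual_op A o\<^sub>L as_H_V \<iota> P) + of_V_H \<iota> (as_V'_H \<iota> P o\<^sub>L A)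
          + of_H_H \<iota> (as_H_H \<iota> P o\<^sub>L as_H_H \<iota> P)) v) w
          = a w \<bullet> T (\<iota> v) + a v \<bullet> T (\<iota> w) + \<iota> (T (\<iota> v)) \<bullet> \<iota> (T (\<iota> w))"
        by (simp add: as_HH as_HV as_V'H of_H_V'_def of_V_H_def of_H_H_def blinfun.bilinear_simps
            pairing_dual_op pairing_to_dual T' a sa)
      also have "\<dots> = pairing (Q v) w"
        by (simp add: T(5) R(1) of_H_H_def pairing_to_dual)
      finally show "pairing ((of_H_V' \<iota> (dual_op A o\<^sub>L as_H_V \<iota> P) + of_V_H \<iota> (as_V'_H \<iota> P o\<^sub>L A)
          + of_H_H \<iota> (as_H_H \<iota> P o\<^sub>L as_H_H \<iota> P)) v) w = pairing (Q v) w" .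
    qed
  qed
qed

end
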